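(* Let $Q$ be a finite quiver. For the direct system of categories $(\operatorname{Mod}W_j(Q),\,i_{j,k})_{j\le k\in\mathbb{N}}$ the colimit exists and is equivalent to $\operatorname{Mod}\mathrm{Idem}(Q)$.
   Context: $Q=(Q_0,Q_1,s,t)$ is a quiver; all modules are finite-dimensional over $\mathbb{C}$ and $\mathbb{N}$ contains $0$. For $j\in\mathbb{N}$ let $Q^j$ be the quiver with vertices $Q_0$ and arrows $Q_1\cup\{\ell_i^x:x\to x\mid x\in Q_0,-j\le i\le j\}$. Define $W_j(Q)=\mathbb{C}Q^j/I_j$, where $I_j$ is the two-sided ideal generated by $\ell_i^x\ell_k^x$ ($i\ne k$, $x\in Q_0$) and $\sum_{i=-j}^j\ell_i^x-e_x$ ($x\in Q_0$), $e_x$ being the trivial path at $x$. For $j>0$ the surjection $W_j(Q)\to W_{j-1}(Q)$ killing $\ell_j^x$ and $\ell_{-j}^x$ for all $x$ induces by restriction a fully faithful functor $i_j:\operatorname{Mod}W_{j-1}(Q)\to\operatorname{Mod}W_j(Q)$; for $k\geq j$ put $i_{j,k}=i_ki_{k-1}\cdots i_{j+1}:\operatorname{Mod}W_j(Q)\to\operatorname{Mod}W_k(Q)$. Let $\widehat Q$ be the quiver with vertices $Q_0$ and arrows $Q_1\cup\{\ell_i^x:x\to x\mid x\in Q_0,i\in\mathbb{Z}\}$. $\operatorname{Mod}\mathrm{Idem}(Q)$ is the full subcategory of $\operatorname{Mod}\mathbb{C}\widehat Q$ of objects such that at each vertex only finitely many of the loops act by non-zero maps, and these non-zero maps form a decomposition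 of the identity at that vertex into orthogonal idempotents. Colimits: for categories $C_i$ and functors $f_{ij}:C_i\to C_j$ ($i\le j$) forming a direct system, a target $\langle X,\phi_i\rangle$ is a category $X$ with functors $\phi_i:C_i\to X$ satisfying $\phi_i=\phi_jf_{ij}$. A target $\langle X,\phi_i\rangle$ is the colimit if for any other target $\langle Y,\psi_i\rangle$ there is a functor $u:X\to Y$, unique up to natural equivalence, with $\psi_i=u\phi_i$ for all $i$. *)

theory Defs
  imports "HOL-Algebra.QuotRing" "HOL-Algebra.Module" "Graph_Theory.Arc_Walk"
    "HOL-Library.FuncSet" Complex_Main
begin

section \<open>Categories, functors, colimits\<close>

record ('o, 'm) category =
  Obj :: "'o set"
  Arr :: "'m set"
  Dom :: "'m \<Rightarrow> 'o"
  Cod :: "'m \<Rightarrow> 'o"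
  Ident :: "'o \<Rightarrow> 'm"
  Comp :: "'m \<Rightarrow> 'm \<Rightarrow> 'm"

definition Hom :: "('o, 'm) category \<Rightarrow> 'o \<Rightarrow> 'o \<Rightarrow> 'm set" where
  "Hom C x y = {f \<in> Arr C. Dom C f = x \<and> Cod C f = y}"

text \<open>\<^term>\<open>Comp C g f\<close> is \<open>g\<close> after \<open>f\<close>.\<close>

definition is_category :: "('o, 'm) category \<Rightarrow> bool" where
  "is_category C \<longleftrightarrow>
     (\<forall>f\<in>Arr C. Dom C f \<in> Obj C \<and> Cod C f \<in> Obj C) \<and>
     (\<forall>x\<in>Obj C. Ident C x \<in> Hom C x x) \<and>
     (\<forall>x y z f g. f \<in> Hom C x y \<and> g \<in> Hom C y z \<longrightarrow> Comp C g f \<in> Hom C x z) \<and>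
     (\<forall>x y f. f \<in> Hom C x y \<longrightarrow> Comp C f (Ident C x) = f \<and> Comp C (Ident C y) f = f) \<and>
     (\<forall>w x y z f g h. f \<in> Hom C w x \<and> g \<in> Hom C x y \<and> h \<in> Hom C y z \<longrightarrow>
        Comp C h (Comp C g f) = Comp C (Comp C h g) f)"

definition full_subcategory :: "('o, 'm) category \<Rightarrow> ('o \<Rightarrow> bool) \<Rightarrow> ('o, 'm) category" where
  "full_subcategory C P =
     C\<lparr>Obj := {x \<in> Obj C. P x}, Arr := {f \<in> Arr C. P (Dom C f) \<and> P (Cod C f)}\<rparr>"

record ('o, 'm, 'p, 'n) cat_functor =
  FObj :: "'o \<Rightarrow> 'p"
  FArr :: "'m \<Rightarrow> 'n"

definition is_functor ::
  "('o, 'm) category \<Rightarrow> ('p, 'n) category \<Rightarrow> ('o, 'm, 'p, 'n) cat_functor \<Rightarrow> bool" where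
  "is_functor C D F \<longleftrightarrow>
     (\<forall>x\<in>Obj C. FObj F x \<in> Obj D) \<and>
     (\<forall>x\<in>Obj C. \<forall>y\<in>Obj C. \<forall>f\<in>Hom C x y. FArr F f \<in> Hom D (FObj F x) (FObj F y)) \<and>
     (\<forall>x\<in>Obj C. FArr F (Ident C x) = Ident D (FObj F x)) \<and>
     (\<forall>x y z f g. f \<in> Hom C x y \<and> g \<in> Hom C y z \<longrightarrow>
        FArr F (Comp C g f) = Comp D (FArr F g) (FArr F f))"

text \<open>Only the values on the objects and arrows of the source category are meaningful, so equality
  of functors is strict equality of these values.\<close>

definition functor_eq ::
  "('o, 'm) category \<Rightarrow> ('o, 'm, 'p, 'n) cat_functor \<Rightarrow> ('o, 'm, 'p, 'n) cat_functor \<Rightarrow> bool" where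
  "functor_eq C F G \<longleftrightarrow>
     (\<forall>x\<in>Obj C. FObj F x = FObj G x) \<and> (\<forall>f\<in>Arr C. FArr F f = FArr G f)"

definition id_functor :: "('o, 'm, 'o, 'm) cat_functor" where
  "id_functor = \<lparr>FObj = id, FArr = id\<rparr>"

definition comp_functor ::
  "('p, 'n, 'q, 'l) cat_functor \<Rightarrow> ('o, 'm, 'p, 'n) cat_functor \<Rightarrow> ('o, 'm, 'q, 'l) cat_functor"
  (infixr \<open>\<circ>\<^sub>F\<close> 55) where
  "G \<circ>\<^sub>F F = \<lparr>FObj = FObj G \<circ> FObj F, FArr = FArr G \<circ> FArr F\<rparr>"

definition is_iso :: "('o, 'm) category \<Rightarrow> 'o \<Rightarrow> 'o \<Rightarrow> 'm \<Rightarrow> bool" where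
  "is_iso C x y f \<longleftrightarrow>
     f \<in> Hom C x y \<and> (\<exists>g\<in>Hom C y x. Comp C g f = Ident C x \<and> Comp C f g = Ident C y)"

definition naturally_equivalent ::
  "('o, 'm) category \<Rightarrow> ('p, 'n) category \<Rightarrow>
     ('o, 'm, 'p, 'n) cat_functor \<Rightarrow> ('o, 'm, 'p, 'n) cat_functor \<Rightarrow> bool" where
  "naturally_equivalent C D F G \<longleftrightarrow>
     (\<exists>\<tau>. (\<forall>x\<in>Obj C. is_iso D (FObj F x) (FObj G x) (\<tau> x)) \<and>
          (\<forall>x\<in>Obj C. \<forall>y\<in>Obj C. \<forall>f\<in>Hom C x y.
             Comp D (\<tau> y) (FArr F f) = Comp D (FArr G f) (\<tau> x)))"

definition equivalent_categories :: "('o, 'm) category \<Rightarrow> ('p, 'n) category \<Rightarrow> bool" where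
  "equivalent_categories C D \<longleftrightarrow>
     (\<exists>F G. is_functor C D F \<and> is_functor D C G \<and>
        naturally_equivalent C C (G \<circ>\<^sub>F F) id_functor \<and>
        naturally_equivalent D D (F \<circ>\<^sub>F G) id_functor)"

definition direct_system ::
  "(nat \<Rightarrow> ('o, 'm) category) \<Rightarrow> (nat \<Rightarrow> nat \<Rightarrow> ('o, 'm, 'o, 'm) cat_functor) \<Rightarrow> bool" where
  "direct_system C f \<longleftrightarrow>
     (\<forall>i. is_category (C i)) \<and>
     (\<forall>i j. i \<le> j \<longrightarrow> is_functor (C i) (C j) (f i j)) \<and>
     (\<forall>i. functor_eq (C i) (f i i) id_functor) \<and>
     (\<forall>i j k. i \<le> j \<and> j \<le> k \<longrightarrow> functor_eq (C i) (f j k \<circ>\<^sub>F f i j) (f i k))"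

definition is_target ::
  "(nat \<Rightarrow> ('o, 'm) category) \<Rightarrow> (nat \<Rightarrow> nat \<Rightarrow> ('o, 'm, 'o, 'm) cat_functor) \<Rightarrow>
     ('p, 'n) category \<Rightarrow> (nat \<Rightarrow> ('o, 'm, 'p, 'n) cat_functor) \<Rightarrow> bool" where
  "is_target C f X \<phi> \<longleftrightarrow>
     is_category X \<and> (\<forall>i. is_functor (C i) X (\<phi> i)) \<and>
     (\<forall>i j. i \<le> j \<longrightarrow> functor_eq (C i) (\<phi> i) (\<phi> j \<circ>\<^sub>F f i j))"

text \<open>A formula of HOL cannot quantify over types, so the type of the categories \<open>Y\<close> against which
  the universal property is tested is passed as a parameter; leaving it a type variable in a
  theorem amounts to testing against all categories.\<close>

definition is_colimit ::
  "('q, 'l) category itself \<Rightarrow>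
     (nat \<Rightarrow> ('o, 'm) category) \<Rightarrow> (nat \<Rightarrow> nat \<Rightarrow> ('o, 'm, 'o, 'm) cat_functor) \<Rightarrow>
     ('p, 'n) category \<Rightarrow> (nat \<Rightarrow> ('o, 'm, 'p, 'n) cat_functor) \<Rightarrow> bool" where
  "is_colimit T C f X \<phi> \<longleftrightarrow>
     direct_system C f \<and> is_target C f X \<phi> \<and>
     (\<forall>(Y :: ('q, 'l) category) \<psi>. is_target C f Y \<psi> \<longrightarrow>
        (\<exists>u. is_functor X Y u \<and> (\<forall>i. functor_eq (C i) (\<psi> i) (u \<circ>\<^sub>F \<phi> i)) \<and>
           (\<forall>u'. is_functor X Y u' \<and> (\<forall>i. functor_eq (C i) (\<psi> i) (u' \<circ>\<^sub>F \<phi> i)) \<longrightarrow>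
              naturally_equivalent X Y u u')))"


section \<open>Finite-dimensional modules over a complex algebra\<close>

text \<open>The library's locale \<^locale>\<open>module\<close> requires a commutative ring of scalars.\<close>

locale left_module = R?: ring R + M?: abelian_group M
  for R (structure) and M :: "('r, 'v) module" (structure) +
  assumes smult_closed:
      "\<lbrakk>a \<in> carrier R; x \<in> carrier M\<rbrakk> \<Longrightarrow> a \<odot>\<^bsub>M\<^esub> x \<in> carrier M"
    and smult_l_distr:
      "\<lbrakk>a \<in> carrier R; b \<in> carrier R; x \<in> carrier M\<rbrakk> \<Longrightarrow>
         (a \<oplus> b) \<odot>\<^bsub>M\<^esub> x = a \<odot>\<^bsub>M\<^esub> x \<oplus>\<^bsub>M\<^esub> b \<odot>\<^bsub>M\<^esub> x"
    and smult_r_distr: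
      "\<lbrakk>a \<in> carrier R; x \<in> carrier M; y \<in> carrier M\<rbrakk> \<Longrightarrow>
         a \<odot>\<^bsub>M\<^esub> (x \<oplus>\<^bsub>M\<^esub> y) = a \<odot>\<^bsub>M\<^esub> x \<oplus>\<^bsub>M\<^esub> a \<odot>\<^bsub>M\<^esub> y"
    and smult_assoc:
      "\<lbrakk>a \<in> carrier R; b \<in> carrier R; x \<in> carrier M\<rbrakk> \<Longrightarrow>
         (a \<otimes> b) \<odot>\<^bsub>M\<^esub> x = a \<odot>\<^bsub>M\<^esub> (b \<odot>\<^bsub>M\<^esub> x)"
    and smult_one:
      "x \<in> carrier M \<Longrightarrow> \<one> \<odot>\<^bsub>M\<^esub> x = x"

text \<open>Functors between module categories are compared strictly, so equality of records has to mean
  equality of modules: the operations are arbitrary but fixed outside their domains, and so are the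
  fields \<^const>\<open>mult\<close> and \<^const>\<open>one\<close>, which the record type of the library provides but
  which play no role for a module.\<close>

definition normalized_module :: "('r, 'z) ring_scheme \<Rightarrow> ('r, 'v) module \<Rightarrow> bool" where
  "normalized_module R M \<longleftrightarrow>
     mult M = undefined \<and> one M = undefined \<and>
     (\<forall>x y. \<not> (x \<in> carrier M \<and> y \<in> carrier M) \<longrightarrow> x \<oplus>\<^bsub>M\<^esub> y = undefined) \<and>
     (\<forall>a x. \<not> (a \<in> carrier R \<and> x \<in> carrier M) \<longrightarrow> a \<odot>\<^bsub>M\<^esub> x = undefined)"

text \<open>A complex algebra is given by its ring \<open>R\<close> and its structure map \<open>\<sigma>\<close>, sending \<open>c\<close> to
  \<open>c \<cdot> 1\<close>.\<close>

definition finite_dimensional :: "(complex \<Rightarrow> 'r) \<Rightarrow> ('r, 'v) module \<Rightarrow> bool" where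
  "finite_dimensional \<sigma> M \<longleftrightarrow>
     (\<exists>B. finite B \<and> B \<subseteq> carrier M \<and>
        (\<forall>m\<in>carrier M. \<exists>c. m = (\<Oplus>\<^bsub>M\<^esub>b\<in>B. \<sigma> (c b) \<odot>\<^bsub>M\<^esub> b)))"

definition module_hom ::
  "('r, 'z) ring_scheme \<Rightarrow> ('r, 'v) module \<Rightarrow> ('r, 'v) module \<Rightarrow> ('v \<Rightarrow> 'v) set" where
  "module_hom R M N =
     {f \<in> carrier M \<rightarrow>\<^sub>E carrier N.
        (\<forall>x\<in>carrier M. \<forall>y\<in>carrier M. f (x \<oplus>\<^bsub>M\<^esub> y) = f x \<oplus>\<^bsub>N\<^esub> f y) \<and>
        (\<forall>a\<in>carrier R. \<forall>x\<in>carrier M. f (a \<odot>\<^bsub>M\<^esub> x) = a \<odot>\<^bsub>N\<^esub> f x)}"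

type_synonym ('r, 'v) module_arrow = "('r, 'v) module \<times> ('v \<Rightarrow> 'v) \<times> ('r, 'v) module"

type_synonym ('r, 'v) module_category = "(('r, 'v) module, ('r, 'v) module_arrow) category"

text \<open>The underlying sets of the modules range over all subsets of the type \<open>'v\<close>, which serves as
  the universe.\<close>

definition Mod_cat :: "('r, 'z) ring_scheme \<Rightarrow> (complex \<Rightarrow> 'r) \<Rightarrow> ('r, 'v) module_category" where
  "Mod_cat R \<sigma> =
     (let Ob = {M. left_module R M \<and> normalized_module R M \<and> finite_dimensional \<sigma> M} in
      \<lparr>Obj = Ob,
       Arr = {(M, f, N). M \<in> Ob \<and> N \<in> Ob \<and> f \<in> module_hom R M N},
       Dom = (\<lambda>(M, f, N). M),
       Cod = (\<lambda>(M, f, N). N),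
       Ident = (\<lambda>M. (M, (\<lambda>x\<in>carrier M. x), M)),
       Comp = (\<lambda>(_, g, P) (M, f, _). (M, compose (carrier M) g f, P))\<rparr>)"

text \<open>Restriction of scalars along \<open>h : R \<rightarrow> S\<close>.\<close>

definition restrict_module ::
  "('r, 'z) ring_scheme \<Rightarrow> ('r \<Rightarrow> 's) \<Rightarrow> ('s, 'v) module \<Rightarrow> ('r, 'v) module" where
  "restrict_module R h M =
     \<lparr>carrier = carrier M, mult = mult M, one = one M, zero = zero M, add = add M,
      smult = (\<lambda>a x. if a \<in> carrier R \<and> x \<in> carrier M then h a \<odot>\<^bsub>M\<^esub> x else undefined)\<rparr>"

definition restriction_functor ::
  "('r, 'z) ring_scheme \<Rightarrow> ('r \<Rightarrow> 's) \<Rightarrow>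
     (('s, 'v) module, ('s, 'v) module_arrow, ('r, 'v) module, ('r, 'v) module_arrow) cat_functor"
  where
  "restriction_functor R h =
     \<lparr>FObj = restrict_module R h,
      FArr = (\<lambda>(M, f, N). (restrict_module R h M, f, restrict_module R h N))\<rparr>"


section \<open>Path algebras\<close>

text \<open>A quiver is a \<^locale>\<open>wf_digraph\<close>: loops and multiple arrows are allowed, and \<^const>\<open>tail\<close>
  and \<^const>\<open>head\<close> are the source and target maps. A path is a triple (source, arrows in the order
  of traversal, target); the trivial path at \<open>x\<close> is \<open>(x, [], x)\<close>.\<close>

type_synonym ('x, 'a) path = "'x \<times> 'a list \<times> 'x"

type_synonym ('x, 'a) path_vector = "('x, 'a) path \<Rightarrow> complex"

definition paths :: "('x, 'a) pre_digraph \<Rightarrow> ('x, 'a) path set" where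
  "paths Q = {(u, p, v). pre_digraph.awalk Q u p v}"

text \<open>Paths are multiplied like maps: \<open>p q\<close> is \<open>q\<close> followed by \<open>p\<close>.\<close>

fun path_product :: "('x, 'a) path \<Rightarrow> ('x, 'a) path \<Rightarrow> ('x, 'a) path option" where
  "path_product (v, p, w) (u, q, v') = (if v = v' then Some (u, q @ p, w) else None)"

text \<open>The sum of the vertex idempotents lies in the carrier for a finite vertex set only.\<close>

definition path_algebra :: "('x, 'a) pre_digraph \<Rightarrow> ('x, 'a) path_vector ring" where
  "path_algebra Q =
     \<lparr>carrier = {f. finite {p. f p \<noteq> 0} \<and> {p. f p \<noteq> 0} \<subseteq> paths Q},
      mult = (\<lambda>f g r. \<Sum>(p, q) \<in> {(p, q). f p \<noteq> 0 \<and> g q \<noteq> 0 \<and> path_product p q = Some r}.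
                 f p * g q),
      one = (\<lambda>p. if p \<in> (\<lambda>x. (x, [], x)) ` verts Q then 1 else 0),
      zero = (\<lambda>p. 0),
      add = (\<lambda>f g p. f p + g p)\<rparr>"

definition path_algebra_scalar ::
  "('x, 'a) pre_digraph \<Rightarrow> complex \<Rightarrow> ('x, 'a) path_vector" where
  "path_algebra_scalar Q c = (\<lambda>p. c * \<one>\<^bsub>path_algebra Q\<^esub> p)"

definition basis_path :: "('x, 'a) path \<Rightarrow> ('x, 'a) path_vector" where
  "basis_path p = (\<lambda>q. if q = p then 1 else 0)"

text \<open>For a subquiver \<open>Q'\<close> of \<open>Q\<close> with the same vertices, the algebra map from the path algebra of
  \<open>Q\<close> to that of \<open>Q'\<close> that kills the arrows outside \<open>Q'\<close>.\<close>

definition kill_arrows :: "('x, 'a) pre_digraph \<Rightarrow> ('x, 'a) path_vector \<Rightarrow> ('x, 'a) path_vector"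
  where
  "kill_arrows Q' f = (\<lambda>p. if p \<in> paths Q' then f p else 0)"


section \<open>The algebras \<open>W\<^sub>j(Q)\<close> and the category \<open>Mod Idem(Q)\<close>\<close>

datatype ('x, 'e) arrow = Arrow 'e | Loop int 'x

text \<open>\<open>Q\<^sup>j\<close> is \<open>with_loops Q {-j..j}\<close>, and the quiver with loops indexed by all integers is
  \<open>with_loops Q UNIV\<close>.\<close>

definition with_loops ::
  "('x, 'e) pre_digraph \<Rightarrow> int set \<Rightarrow> ('x, ('x, 'e) arrow) pre_digraph" where
  "with_loops Q J =
     \<lparr>verts = verts Q,
      arcs = Arrow ` arcs Q \<union> {Loop i x | i x. i \<in> J \<and> x \<in> verts Q},
      tail = (\<lambda>a. case a of Arrow e \<Rightarrow> tail Q e | Loop i x \<Rightarrow> x),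
      head = (\<lambda>a. case a of Arrow e \<Rightarrow> head Q e | Loop i x \<Rightarrow> x)\<rparr>"

type_synonym ('x, 'e) loop_vector = "('x, ('x, 'e) arrow) path_vector"

definition vertex_elem :: "'x \<Rightarrow> ('x, 'e) loop_vector" where
  "vertex_elem x = basis_path (x, [], x)"

definition loop_elem :: "int \<Rightarrow> 'x \<Rightarrow> ('x, 'e) loop_vector" where
  "loop_elem i x = basis_path (x, [Loop i x], x)"

definition CQ :: "('x, 'e) pre_digraph \<Rightarrow> nat \<Rightarrow> ('x, 'e) loop_vector ring" where
  "CQ Q j = path_algebra (with_loops Q {- int j..int j})"

definition I_ideal :: "('x, 'e) pre_digraph \<Rightarrow> nat \<Rightarrow> ('x, 'e) loop_vector set" where
  "I_ideal Q j = Idl\<^bsub>CQ Q j\<^esub>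
     ({loop_elem i x \<otimes>\<^bsub>CQ Q j\<^esub> loop_elem k x | i k x.
         x \<in> verts Q \<and> i \<in> {- int j..int j} \<and> k \<in> {- int j..int j} \<and> i \<noteq> k} \<union>
      {(\<Oplus>\<^bsub>CQ Q j\<^esub>i\<in>{- int j..int j}. loop_elem i x) \<ominus>\<^bsub>CQ Q j\<^esub> vertex_elem x | x. x \<in> verts Q})"

definition W :: "('x, 'e) pre_digraph \<Rightarrow> nat \<Rightarrow> ('x, 'e) loop_vector set ring" where
  "W Q j = CQ Q j Quot I_ideal Q j"

definition W_class ::
  "('x, 'e) pre_digraph \<Rightarrow> nat \<Rightarrow> ('x, 'e) loop_vector \<Rightarrow> ('x, 'e) loop_vector set" where
  "W_class Q j f = I_ideal Q j +>\<^bsub>CQ Q j\<^esub> f"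

definition W_scalar :: "('x, 'e) pre_digraph \<Rightarrow> nat \<Rightarrow> complex \<Rightarrow> ('x, 'e) loop_vector set" where
  "W_scalar Q j c = W_class Q j (path_algebra_scalar (with_loops Q {- int j..int j}) c)"

definition Mod_W ::
  "('x, 'e) pre_digraph \<Rightarrow> nat \<Rightarrow> (('x, 'e) loop_vector set, 'v) module_category" where
  "Mod_W Q j = Mod_cat (W Q j) (W_scalar Q j)"

text \<open>The surjection from \<open>W\<^bsub>j+1\<^esub>(Q)\<close> to \<open>W\<^sub>j(Q)\<close> sends the class of \<open>f\<close> to the class of its image
  under the map killing the loops with indices \<open>\<plusminus>(j+1)\<close>.\<close>

definition W_surj ::
  "('x, 'e) pre_digraph \<Rightarrow> nat \<Rightarrow> ('x, 'e) loop_vector set \<Rightarrow> ('x, 'e) loop_vector set" where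
  "W_surj Q j X =
     the_elem ((\<lambda>f. W_class Q j (kill_arrows (with_loops Q {- int j..int j}) f)) ` X)"

type_synonym ('r, 'v) module_endofunctor =
  "(('r, 'v) module, ('r, 'v) module_arrow, ('r, 'v) module, ('r, 'v) module_arrow) cat_functor"

text \<open>\<open>i_step Q j\<close> is the functor \<open>i\<^bsub>j+1\<^esub>\<close> from \<open>Mod W\<^sub>j(Q)\<close> to \<open>Mod W\<^bsub>j+1\<^esub>(Q)\<close>.\<close>

definition i_step ::
  "('x, 'e) pre_digraph \<Rightarrow> nat \<Rightarrow> (('x, 'e) loop_vector set, 'v) module_endofunctor" where
  "i_step Q j = restriction_functor (W Q (Suc j)) (W_surj Q j)"

primrec i_functor ::
  "('x, 'e) pre_digraph \<Rightarrow> nat \<Rightarrow> nat \<Rightarrow> (('x, 'e) loop_vector set, 'v) module_endofunctor" where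
  "i_functor Q j 0 = id_functor"
| "i_functor Q j (Suc k) = (if j \<le> k then i_step Q k \<circ>\<^sub>F i_functor Q j k else id_functor)"

definition CQ_hat :: "('x, 'e) pre_digraph \<Rightarrow> ('x, 'e) loop_vector ring" where
  "CQ_hat Q = path_algebra (with_loops Q UNIV)"

definition vertex_space :: "(('x, 'e) loop_vector, 'v) module \<Rightarrow> 'x \<Rightarrow> 'v set" where
  "vertex_space M x = {vertex_elem x \<odot>\<^bsub>M\<^esub> m | m. m \<in> carrier M}"

definition nonzero_loops :: "(('x, 'e) loop_vector, 'v) module \<Rightarrow> 'x \<Rightarrow> int set" where
  "nonzero_loops M x = {i. \<exists>m\<in>vertex_space M x. loop_elem i x \<odot>\<^bsub>M\<^esub> m \<noteq> \<zero>\<^bsub>M\<^esub>}"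

definition idem_decomposition ::
  "('x, 'e) pre_digraph \<Rightarrow> (('x, 'e) loop_vector, 'v) module \<Rightarrow> bool" where
  "idem_decomposition Q M \<longleftrightarrow>
     (\<forall>x\<in>verts Q.
        finite (nonzero_loops M x) \<and>
        (\<forall>i\<in>nonzero_loops M x. \<forall>m\<in>vertex_space M x.
           loop_elem i x \<odot>\<^bsub>M\<^esub> (loop_elem i x \<odot>\<^bsub>M\<^esub> m) = loop_elem i x \<odot>\<^bsub>M\<^esub> m) \<and>
        (\<forall>i\<in>nonzero_loops M x. \<forall>k\<in>nonzero_loops M x. i \<noteq> k \<longrightarrow>
           (\<forall>m\<in>vertex_space M x. loop_elem i x \<odot>\<^bsub>M\<^esub> (loop_elem k x \<odot>\<^bsub>M\<^esub> m) = \<zero>\<^bsub>M\<^esub>)) \<and>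
        (\<forall>m\<in>vertex_space M x.
           (\<Oplus>\<^bsub>M\<^esub>i\<in>nonzero_loops M x. loop_elem i x \<odot>\<^bsub>M\<^esub> m) = m))"

definition Mod_Idem :: "('x, 'e) pre_digraph \<Rightarrow> (('x, 'e) loop_vector, 'v) module_category" where
  "Mod_Idem Q =
     full_subcategory (Mod_cat (CQ_hat Q) (path_algebra_scalar (with_loops Q UNIV)))
       (idem_decomposition Q)"

text \<open>The canonical functor from \<open>Mod W\<^sub>j(Q)\<close> to \<open>Mod Idem(Q)\<close>: restriction along the algebra map
  onto \<open>W\<^sub>j(Q)\<close> that kills the loops with indices outside \<open>{-j..j}\<close>.\<close>

definition to_Idem ::
  "('x, 'e) pre_digraph \<Rightarrow> nat \<Rightarrow>
     ((('x, 'e) loop_vector set, 'v) module, (('x, 'e) loop_vector set, 'v) module_arrow,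
      (('x, 'e) loop_vector, 'v) module, (('x, 'e) loop_vector, 'v) module_arrow) cat_functor" where
  "to_Idem Q j =
     restriction_functor (CQ_hat Q)
       (\<lambda>f. W_class Q j (kill_arrows (with_loops Q {- int j..int j}) f))"

end

theory Submission
  imports Defs
begin

text \<open>
  Write \<open>\<phi>\<^sub>j\<close> for the functor \<^term>\<open>to_Idem Q j\<close> from the modules over \<open>W\<^sub>j(Q)\<close> to
  \<open>Mod Idem(Q)\<close>. The theorem holds because \<open>Mod Idem(Q)\<close> is, on the nose, the increasing union of
  the images of the \<open>\<phi>\<^sub>j\<close>, and each \<open>\<phi>\<^sub>j\<close> is a fully faithful embedding which is injective on
  objects.

  Each \<open>\<phi>\<^sub>j\<close> is restriction of scalars along the surjection \<open>W_proj Q j\<close> from the path algebra of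
  the quiver with all loops onto \<open>W\<^sub>j(Q)\<close>. Restriction along a surjection \<open>h\<close> loses nothing: a
  module is determined by its restriction, linearity may be tested on either side, and the modules
  that arise are exactly those on which elements with the same image under \<open>h\<close> act in the same way
  (locale \<open>scalar_restriction\<close>, in particular \<open>restriction_inj_on_arr\<close>, \<open>descend_obj\<close> and
  \<open>arr_in_image\<close>).

  The image of \<open>\<phi>\<^sub>j\<close> consists of the modules in \<open>Mod Idem(Q)\<close> whose nonzero loops have indices
  between \<open>-j\<close> and \<open>j\<close>. The kernel of \<open>W_proj Q j\<close> is generated by the loops outside this range
  together with the defining relations of \<open>W\<^sub>j(Q)\<close>, and the annihilator of a module is a two-sided
  ideal; so it is enough to see which generators act as zero, and these conditions say that the
  nonzero loops decompose the identity at every vertex (\<open>kernel_annihilates\<close>,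
  \<open>idem_decompositionI\<close>). As \<open>Q\<close> has finitely many vertices and only finitely many loops act
  nontrivially at each of them, every object and every arrow of \<open>Mod Idem(Q)\<close> lies in the image of
  some \<open>\<phi>\<^sub>j\<close> (\<open>Mod_Idem_arr_in_image\<close>).

  A compatible family of functors on the stages of such a union glues to a functor on the union,
  and the gluing is unique even up to equality (\<open>exhaustive_embeddings_colimit\<close>). That every other
  colimit is equivalent to this one is the usual argument from the universal property
  (\<open>colimits_equivalent\<close>).
\<close>

section \<open>Categories, functors and colimits\<close>

lemma Hom_iff: "f \<in> Hom C x y \<longleftrightarrow> f \<in> Arr C \<and> Dom C f = x \<and> Cod C f = y"
  by (auto simp: Hom_def)

lemma category_arr:
  assumes "is_category C" "f \<in> Arr C"
  shows "Dom C f \<in> Obj C" "Cod C f \<in> Obj C"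
  using assms by (auto simp: is_category_def)

lemma category_ident:
  assumes "is_category C" "x \<in> Obj C"
  shows "Ident C x \<in> Arr C" "Dom C (Ident C x) = x" "Cod C (Ident C x) = x"
  using assms by (auto simp: is_category_def Hom_iff)

lemma category_comp:
  assumes "is_category C" "f \<in> Hom C x y" "g \<in> Hom C y z"
  shows "Comp C g f \<in> Hom C x z"
  using assms unfolding is_category_def by blast

lemma category_ident_comp:
  assumes "is_category C" "f \<in> Hom C x y"
  shows "Comp C f (Ident C x) = f" "Comp C (Ident C y) f = f"
  using assms unfolding is_category_def by blast+

lemma category_assoc:
  assumes "is_category C" "f \<in> Hom C w x" "g \<in> Hom C x y" "h \<in> Hom C y z"
  shows "Comp C h (Comp C g f) = Comp C (Comp C h g) f"
  using assms unfolding is_category_def by blast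

lemma functor_arr:
  assumes "is_functor C D F" "is_category C" "f \<in> Arr C"
  shows "FArr F f \<in> Arr D" "Dom D (FArr F f) = FObj F (Dom C f)"
    "Cod D (FArr F f) = FObj F (Cod C f)"
proof -
  have "FArr F f \<in> Hom D (FObj F (Dom C f)) (FObj F (Cod C f))"
    using assms category_arr[OF assms(2,3)] unfolding is_functor_def by (auto simp: Hom_iff)
  then show "FArr F f \<in> Arr D" "Dom D (FArr F f) = FObj F (Dom C f)"
    "Cod D (FArr F f) = FObj F (Cod C f)"
    by (auto simp: Hom_iff)
qed

lemma functor_hom:
  assumes "is_functor C D F" "is_category C" "f \<in> Hom C x y"
  shows "FArr F f \<in> Hom D (FObj F x) (FObj F y)"
  using functor_arr[OF assms(1,2)] assms(3) by (auto simp: Hom_iff)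

lemma functor_obj:
  assumes "is_functor C D F" "x \<in> Obj C"
  shows "FObj F x \<in> Obj D" "FArr F (Ident C x) = Ident D (FObj F x)"
  using assms by (auto simp: is_functor_def)

lemma functor_comp:
  assumes "is_functor C D F" "f \<in> Hom C x y" "g \<in> Hom C y z"
  shows "FArr F (Comp C g f) = Comp D (FArr F g) (FArr F f)"
  using assms unfolding is_functor_def by blast

lemma is_functorI:
  assumes "\<And>x. x \<in> Obj C \<Longrightarrow> FObj F x \<in> Obj D"
    and "\<And>f. f \<in> Arr C \<Longrightarrow> FArr F f \<in> Arr D \<and> Dom D (FArr F f) = FObj F (Dom C f)
      \<and> Cod D (FArr F f) = FObj F (Cod C f)"
    and "\<And>x. x \<in> Obj C \<Longrightarrow> FArr F (Ident C x) = Ident D (FObj F x)"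
    and "\<And>f g. \<lbrakk>f \<in> Arr C; g \<in> Arr C; Cod C f = Dom C g\<rbrakk> \<Longrightarrow>
      FArr F (Comp C g f) = Comp D (FArr F g) (FArr F f)"
  shows "is_functor C D F"
  using assms unfolding is_functor_def Hom_def by auto

lemma comp_functor_simps [simp]:
  "FObj (G \<circ>\<^sub>F F) x = FObj G (FObj F x)" "FArr (G \<circ>\<^sub>F F) f = FArr G (FArr F f)"
  by (simp_all add: comp_functor_def)

lemma id_functor_simps [simp]: "FObj id_functor x = x" "FArr id_functor f = f"
  by (simp_all add: id_functor_def)

lemma id_is_functor: "is_functor C C id_functor"
  by (auto simp: is_functor_def)

lemma comp_is_functor:
  assumes "is_category C" "is_functor C D F" "is_functor D E G"
  shows "is_functor C E (G \<circ>\<^sub>F F)"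
  unfolding is_functor_def
proof (intro conjI ballI allI impI)
  fix x y z f g assume "f \<in> Hom C x y \<and> g \<in> Hom C y z"
  then have fg: "f \<in> Hom C x y" "g \<in> Hom C y z" by auto
  note hom = functor_hom[OF assms(2,1)]
  show "FArr (G \<circ>\<^sub>F F) (Comp C g f) = Comp E (FArr (G \<circ>\<^sub>F F) g) (FArr (G \<circ>\<^sub>F F) f)"
    using functor_comp[OF assms(2) fg] functor_comp[OF assms(3) hom[OF fg(1)] hom[OF fg(2)]] by simp
next
  fix x y f assume xy: "x \<in> Obj C" "y \<in> Obj C" and f: "f \<in> Hom C x y"
  have "FObj F x \<in> Obj D" "FObj F y \<in> Obj D"
    using functor_obj(1)[OF assms(2)] xy by auto
  then show "FArr (G \<circ>\<^sub>F F) f \<in> Hom E (FObj (G \<circ>\<^sub>F F) x) (FObj (G \<circ>\<^sub>F F) y)"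
    using assms(3) functor_hom[OF assms(2,1) f] unfolding is_functor_def by auto
qed (auto simp: functor_obj[OF assms(2)] functor_obj[OF assms(3)])

lemma comp_functor_assoc: "(H \<circ>\<^sub>F G) \<circ>\<^sub>F F = H \<circ>\<^sub>F (G \<circ>\<^sub>F F)"
  by (simp add: comp_functor_def comp_assoc)

lemma full_subcategory_is_category:
  assumes "is_category C"
  shows "is_category (full_subcategory C P)"
proof -
  have Hom: "f \<in> Hom (full_subcategory C P) x y \<longleftrightarrow> f \<in> Hom C x y \<and> P x \<and> P y" for f x y
    by (auto simp: Hom_def full_subcategory_def)
  show ?thesis
    using assms unfolding is_category_def Hom by (auto simp: full_subcategory_def)
qed

lemma functor_into_full_subcategory:
  assumes "is_functor C D F" "\<And>x. x \<in> Obj C \<Longrightarrow> P (FObj F x)" "is_category C"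
  shows "is_functor C (full_subcategory D P) F"
proof (rule is_functorI)
  fix x assume "x \<in> Obj C"
  then show "FObj F x \<in> Obj (full_subcategory D P)"
    and "FArr F (Ident C x) = Ident (full_subcategory D P) (FObj F x)"
    using functor_obj[OF assms(1)] assms(2) by (simp_all add: full_subcategory_def)
next
  fix f assume f: "f \<in> Arr C"
  show "FArr F f \<in> Arr (full_subcategory D P)
    \<and> Dom (full_subcategory D P) (FArr F f) = FObj F (Dom C f)
    \<and> Cod (full_subcategory D P) (FArr F f) = FObj F (Cod C f)"
    using functor_arr[OF assms(1,3) f] assms(2) category_arr[OF assms(3) f]
    by (simp add: full_subcategory_def)
next
  fix f g assume "f \<in> Arr C" "g \<in> Arr C" "Cod C f = Dom C g"
  then show "FArr F (Comp C g f) = Comp (full_subcategory D P) (FArr F g) (FArr F f)"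
    using functor_comp[OF assms(1), of f "Dom C f" "Cod C f" g "Cod C g"]
    by (simp add: Hom_iff full_subcategory_def)
qed

lemma naturally_equivalent_of_eq:
  assumes "is_category C" "is_category D" "is_functor C D F" "functor_eq C F G"
  shows "naturally_equivalent C D F G"
  unfolding naturally_equivalent_def
proof (intro exI[of _ "\<lambda>x. Ident D (FObj F x)"] conjI ballI)
  fix x assume x: "x \<in> Obj C"
  then have Fx: "FObj F x \<in> Obj D" "FObj G x = FObj F x"
    using functor_obj(1)[OF assms(3) x] assms(4) x by (auto simp: functor_eq_def)
  have id: "Ident D (FObj F x) \<in> Hom D (FObj F x) (FObj F x)"
    using category_ident[OF assms(2) Fx(1)] by (simp add: Hom_iff)
  show "is_iso D (FObj F x) (FObj G x) (Ident D (FObj F x))"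
    unfolding is_iso_def Fx(2)
    using id category_ident_comp(1)[OF assms(2) id] by (intro conjI bexI[of _ "Ident D (FObj F x)"])
next
  fix x y f assume f: "f \<in> Hom C x y"
  then have "FArr G f = FArr F f" using assms(4) by (auto simp: functor_eq_def Hom_iff)
  then show "Comp D (Ident D (FObj F y)) (FArr F f) = Comp D (FArr G f) (Ident D (FObj F x))"
    using category_ident_comp[OF assms(2) functor_hom[OF assms(3,1) f]] by simp
qed

text \<open>
  The universal property compares every competing functor with one chosen functor \<open>H\<close>. Two
  competitors are compared with each other by inverting the first comparison: if \<open>\<alpha>\<close> and \<open>\<beta>\<close> are
  the isomorphisms from \<open>H\<close> to \<open>F\<close> and to \<open>G\<close>, the composites of \<open>\<beta>\<close> with the inverses of \<open>\<alpha>\<close> do it.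
\<close>

lemma naturally_equivalent_common_source:
  assumes D: "is_category D" and F: "is_functor C D F" and G: "is_functor C D G"
    and H: "is_functor C D H" and C: "is_category C"
    and HF: "naturally_equivalent C D H F" and HG: "naturally_equivalent C D H G"
  shows "naturally_equivalent C D F G"
proof -
  obtain \<alpha> where \<alpha>: "\<And>x. x \<in> Obj C \<Longrightarrow> is_iso D (FObj H x) (FObj F x) (\<alpha> x)"
    "\<And>x y f. \<lbrakk>x \<in> Obj C; y \<in> Obj C; f \<in> Hom C x y\<rbrakk> \<Longrightarrow>
       Comp D (\<alpha> y) (FArr H f) = Comp D (FArr F f) (\<alpha> x)"
    using HF unfolding naturally_equivalent_def by blast
  obtain \<beta> where \<beta>: "\<And>x. x \<in> Obj C \<Longrightarrow> is_iso D (FObj H x) (FObj G x) (\<beta> x)"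
    "\<And>x y f. \<lbrakk>x \<in> Obj C; y \<in> Obj C; f \<in> Hom C x y\<rbrakk> \<Longrightarrow>
       Comp D (\<beta> y) (FArr H f) = Comp D (FArr G f) (\<beta> x)"
    using HG unfolding naturally_equivalent_def by blast
  have "\<forall>x\<in>Obj C. \<exists>a. a \<in> Hom D (FObj F x) (FObj H x) \<and>
      Comp D a (\<alpha> x) = Ident D (FObj H x) \<and> Comp D (\<alpha> x) a = Ident D (FObj F x)"
    using \<alpha>(1) unfolding is_iso_def by blast
  then obtain \<alpha>' where \<alpha>': "\<And>x. x \<in> Obj C \<Longrightarrow> \<alpha>' x \<in> Hom D (FObj F x) (FObj H x) \<and>
      Comp D (\<alpha>' x) (\<alpha> x) = Ident D (FObj H x) \<and> Comp D (\<alpha> x) (\<alpha>' x) = Ident D (FObj F x)"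
    by metis
  have \<alpha>h: "\<alpha> x \<in> Hom D (FObj H x) (FObj F x)" if "x \<in> Obj C" for x
    using \<alpha>(1)[OF that] by (simp add: is_iso_def)
  have \<beta>h: "\<beta> x \<in> Hom D (FObj H x) (FObj G x)" if "x \<in> Obj C" for x
    using \<beta>(1)[OF that] by (simp add: is_iso_def)
  have iso: "is_iso D (FObj F x) (FObj G x) (Comp D (\<beta> x) (\<alpha>' x))" if x: "x \<in> Obj C" for x
  proof -
    obtain b where b: "b \<in> Hom D (FObj G x) (FObj H x)" "Comp D b (\<beta> x) = Ident D (FObj H x)"
      "Comp D (\<beta> x) b = Ident D (FObj G x)"
      using \<beta>(1)[OF x] by (auto simp: is_iso_def)
    note a = \<alpha>'[OF x, THEN conjunct1] and a1 = \<alpha>'[OF x, THEN conjunct2, THEN conjunct1]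
      and a2 = \<alpha>'[OF x, THEN conjunct2, THEN conjunct2]
    note ca = category_assoc[OF D] and ci = category_ident_comp[OF D]
      and cc = category_comp[OF D]
    have 1: "Comp D (Comp D (\<alpha> x) b) (Comp D (\<beta> x) (\<alpha>' x)) = Ident D (FObj F x)"
    proof -
      have "Comp D b (Comp D (\<beta> x) (\<alpha>' x)) = \<alpha>' x"
        using ca[OF a \<beta>h[OF x] b(1)] b(2) ci(2)[OF a] by simp
      then show ?thesis
        using ca[OF cc[OF a \<beta>h[OF x]] b(1) \<alpha>h[OF x]] a2 by simp
    qed
    have 2: "Comp D (Comp D (\<beta> x) (\<alpha>' x)) (Comp D (\<alpha> x) b) = Ident D (FObj G x)"
    proof -
      have "Comp D (\<alpha>' x) (Comp D (\<alpha> x) b) = b"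
        using ca[OF b(1) \<alpha>h[OF x] a] a1 ci(2)[OF b(1)] by simp
      then show ?thesis
        using ca[OF cc[OF b(1) \<alpha>h[OF x]] a \<beta>h[OF x]] b(3) by simp
    qed
    show ?thesis
      unfolding is_iso_def using 1 2 cc[OF a \<beta>h[OF x]] cc[OF b(1) \<alpha>h[OF x]]
      by (intro conjI bexI[of _ "Comp D (\<alpha> x) b"])
  qed
  have nat: "Comp D (Comp D (\<beta> y) (\<alpha>' y)) (FArr F f) = Comp D (FArr G f) (Comp D (\<beta> x) (\<alpha>' x))"
    if xy: "x \<in> Obj C" "y \<in> Obj C" and f: "f \<in> Hom C x y" for x y f
  proof -
    note ca = category_assoc[OF D] and ci = category_ident_comp[OF D]
      and cc = category_comp[OF D]
    note Ff = functor_hom[OF F C f] and Gf = functor_hom[OF G C f] and Hf = functor_hom[OF H C f]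
    note ax = \<alpha>'[OF xy(1), THEN conjunct1] and ay = \<alpha>'[OF xy(2), THEN conjunct1]
    have "Comp D (\<alpha>' y) (FArr F f) = Comp D (\<alpha>' y) (Comp D (FArr F f) (Comp D (\<alpha> x) (\<alpha>' x)))"
      using \<alpha>'[OF xy(1)] ci(1)[OF Ff] by simp
    also have "\<dots> = Comp D (\<alpha>' y) (Comp D (Comp D (\<alpha> y) (FArr H f)) (\<alpha>' x))"
      using ca[OF ax \<alpha>h[OF xy(1)] Ff] \<alpha>(2)[OF xy f] by simp
    also have "\<dots> = Comp D (\<alpha>' y) (Comp D (\<alpha> y) (Comp D (FArr H f) (\<alpha>' x)))"
      using ca[OF ax Hf \<alpha>h[OF xy(2)]] by simp
    also have "\<dots> = Comp D (FArr H f) (\<alpha>' x)"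
      using ca[OF cc[OF ax Hf] \<alpha>h[OF xy(2)] ay] \<alpha>'[OF xy(2)] ci(2)[OF cc[OF ax Hf]] by simp
    finally have *: "Comp D (\<alpha>' y) (FArr F f) = Comp D (FArr H f) (\<alpha>' x)" .
    have "Comp D (Comp D (\<beta> y) (\<alpha>' y)) (FArr F f) = Comp D (\<beta> y) (Comp D (FArr H f) (\<alpha>' x))"
      using ca[OF Ff ay \<beta>h[OF xy(2)]] * by simp
    also have "\<dots> = Comp D (Comp D (FArr G f) (\<beta> x)) (\<alpha>' x)"
      using ca[OF ax Hf \<beta>h[OF xy(2)]] \<beta>(2)[OF xy f] by simp
    also have "\<dots> = Comp D (FArr G f) (Comp D (\<beta> x) (\<alpha>' x))"
      using ca[OF ax \<beta>h[OF xy(1)] Gf] by simp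
    finally show ?thesis .
  qed
  show ?thesis
    unfolding naturally_equivalent_def
    by (intro exI[of _ "\<lambda>x. Comp D (\<beta> x) (\<alpha>' x)"] conjI ballI iso nat)
qed

lemma colimit_factor:
  fixes Y :: "('q, 'l) category"
  assumes "is_colimit TYPE(('q, 'l) category) C f X \<phi>" and "is_target C f Y \<psi>"
  shows "\<exists>u. is_functor X Y u \<and> (\<forall>i. functor_eq (C i) (\<psi> i) (u \<circ>\<^sub>F \<phi> i)) \<and>
    (\<forall>u'. is_functor X Y u' \<and> (\<forall>i. functor_eq (C i) (\<psi> i) (u' \<circ>\<^sub>F \<phi> i)) \<longrightarrow>
       naturally_equivalent X Y u u')"
  using assms(1)[unfolded is_colimit_def, THEN conjunct2, THEN conjunct2, rule_format, OF assms(2)] .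

text \<open>
  The colimit tests the universal property against itself, with its own cocone as the target; the
  identity is one solution and \<open>u\<close> is another.
\<close>

lemma colimit_endofunctor:
  fixes X :: "('p, 'n) category"
  assumes "is_colimit TYPE(('p, 'n) category) C f X \<phi>" "is_functor X X u"
    and "\<And>i. functor_eq (C i) (\<phi> i) (u \<circ>\<^sub>F \<phi> i)"
  shows "naturally_equivalent X X u id_functor"
proof -
  have t: "is_target C f X \<phi>" and X: "is_category X"
    using assms(1) by (auto simp: is_colimit_def is_target_def)
  obtain v where v: "is_functor X X v"
    "\<forall>u'. is_functor X X u' \<and> (\<forall>i. functor_eq (C i) (\<phi> i) (u' \<circ>\<^sub>F \<phi> i)) \<longrightarrow>
      naturally_equivalent X X v u'"
    using colimit_factor[OF assms(1) t] by blast
  have "functor_eq (C i) (\<phi> i) (id_functor \<circ>\<^sub>F \<phi> i)" for i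
    by (simp add: functor_eq_def)
  then show ?thesis
    using naturally_equivalent_common_source[OF X assms(2) id_is_functor v(1) X]
      v(2)[rule_format, of u] v(2)[rule_format, of id_functor] assms(2,3) id_is_functor[of X]
    by simp
qed

lemma colimits_equivalent:
  fixes X :: "('p, 'n) category" and Z :: "('q, 'l) category"
  assumes XX: "is_colimit TYPE(('p, 'n) category) C f X \<phi>"
    and XZ: "is_colimit TYPE(('q, 'l) category) C f X \<phi>"
    and ZX: "is_colimit TYPE(('p, 'n) category) C f Z \<chi>"
    and ZZ: "is_colimit TYPE(('q, 'l) category) C f Z \<chi>"
  shows "equivalent_categories X Z"
proof -
  have tX: "is_target C f X \<phi>" and X: "is_category X" and tZ: "is_target C f Z \<chi>"
    and Z: "is_category Z" and C: "\<And>i. is_category (C i)"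
    using XX ZZ by (auto simp: is_colimit_def is_target_def direct_system_def)
  obtain F where F: "is_functor X Z F" "\<forall>i. functor_eq (C i) (\<chi> i) (F \<circ>\<^sub>F \<phi> i)"
    using colimit_factor[OF XZ tZ] by blast
  obtain G where G: "is_functor Z X G" "\<forall>i. functor_eq (C i) (\<phi> i) (G \<circ>\<^sub>F \<chi> i)"
    using colimit_factor[OF ZX tX] by blast
  have "functor_eq (C i) (\<phi> i) ((G \<circ>\<^sub>F F) \<circ>\<^sub>F \<phi> i)" for i
    using F(2)[rule_format, of i] G(2)[rule_format, of i] by (simp add: functor_eq_def)
  then have 1: "naturally_equivalent X X (G \<circ>\<^sub>F F) id_functor"
    using colimit_endofunctor[OF XX comp_is_functor[OF X F(1) G(1)]] by blast
  have "functor_eq (C i) (\<chi> i) ((F \<circ>\<^sub>F G) \<circ>\<^sub>F \<chi> i)" for i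
    using F(2)[rule_format, of i] G(2)[rule_format, of i] by (simp add: functor_eq_def)
  then have 2: "naturally_equivalent Z Z (F \<circ>\<^sub>F G) id_functor"
    using colimit_endofunctor[OF ZZ comp_is_functor[OF Z G(1) F(1)]] by blast
  show ?thesis
    unfolding equivalent_categories_def using F(1) G(1) 1 2 by blast
qed

lemma target_arr:
  assumes "is_target C f X \<phi>" "i \<le> j" "a \<in> Arr (C i)"
  shows "FArr (\<phi> j) (FArr (f i j) a) = FArr (\<phi> i) a"
proof -
  have "functor_eq (C i) (\<phi> i) (\<phi> j \<circ>\<^sub>F f i j)"
    using assms(1,2) by (simp add: is_target_def)
  then have "FArr (\<phi> i) a = FArr (\<phi> j \<circ>\<^sub>F f i j) a"
    unfolding functor_eq_def using assms(3) by blast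
  then show ?thesis by simp
qed

text \<open>
  Only arrows occur in the hypotheses, since an object can be recovered from its identity arrow. A
  cocone \<open>\<psi>\<close> is extended to \<open>X\<close> by sending an arrow of \<open>X\<close> to the value of \<open>\<psi>\<close> at any of its
  preimages. Any two preimages, and any two composable arrows, can be moved to a common stage, where
  injectivity of \<open>\<phi>\<close> shows that the choice does not matter and that composability is already visible
  there.
\<close>

lemma exhaustive_embeddings_colimit:
  assumes ds: "direct_system C f" and tgt: "is_target C f X \<phi>"
    and inj: "\<And>i. inj_on (FArr (\<phi> i)) (Arr (C i))"
    and exh: "\<And>g. g \<in> Arr X \<Longrightarrow> \<exists>i. g \<in> FArr (\<phi> i) ` Arr (C i)"
  shows "is_colimit T C f X \<phi>"
proof -
  have C: "is_category (C i)" for i using ds by (simp add: direct_system_def)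
  have f: "is_functor (C i) (C j) (f i j)" if "i \<le> j" for i j
    using ds that by (simp add: direct_system_def)
  have X: "is_category X" and \<phi>: "is_functor (C i) X (\<phi> i)" for i
    using tgt by (auto simp: is_target_def)
  have \<phi>f: "FArr (\<phi> j) (FArr (f i j) a) = FArr (\<phi> i) a" if "i \<le> j" "a \<in> Arr (C i)" for i j a
    by (rule target_arr[OF tgt that])
  have inj_obj: "x = y"
    if "FObj (\<phi> i) x = FObj (\<phi> i) y" "x \<in> Obj (C i)" "y \<in> Obj (C i)" for i x y
  proof -
    have "FArr (\<phi> i) (Ident (C i) x) = FArr (\<phi> i) (Ident (C i) y)"
      unfolding functor_obj(2)[OF \<phi> that(2)] functor_obj(2)[OF \<phi> that(3)] that(1) ..
    then have "Ident (C i) x = Ident (C i) y"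
      by (rule inj_onD[OF inj]) (simp_all add: category_ident(1)[OF C] that)
    then have "Dom (C i) (Ident (C i) x) = Dom (C i) (Ident (C i) y)" by (rule arg_cong)
    then show ?thesis
      unfolding category_ident(2)[OF C that(2)] category_ident(2)[OF C that(3)] .
  qed
  have exh_obj: "\<exists>i a. a \<in> Obj (C i) \<and> x = FObj (\<phi> i) a" if x: "x \<in> Obj X" for x
  proof -
    obtain i a where a: "a \<in> Arr (C i)" "Ident X x = FArr (\<phi> i) a"
      using exh[OF category_ident(1)[OF X x]] by blast
    have "x = FObj (\<phi> i) (Dom (C i) a)"
      using category_ident(2)[OF X x] unfolding a(2) functor_arr(2)[OF \<phi> C a(1)] by (rule sym)
    moreover have "Dom (C i) a \<in> Obj (C i)"
      by (rule category_arr(1)[OF C a(1)])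
    ultimately show ?thesis by blast
  qed
  have univ: "\<exists>u. is_functor X Y u \<and> (\<forall>i. functor_eq (C i) (\<psi> i) (u \<circ>\<^sub>F \<phi> i)) \<and>
           (\<forall>u'. is_functor X Y u' \<and> (\<forall>i. functor_eq (C i) (\<psi> i) (u' \<circ>\<^sub>F \<phi> i)) \<longrightarrow>
              naturally_equivalent X Y u u')"
    if Yt: "is_target C f Y \<psi>" for Y :: "('e, 'f) category" and \<psi>
  proof -
    have Y: "is_category Y" and \<psi>: "is_functor (C i) Y (\<psi> i)" for i
      using Yt by (auto simp: is_target_def)
    have \<psi>f: "FArr (\<psi> j) (FArr (f i j) a) = FArr (\<psi> i) a" if "i \<le> j" "a \<in> Arr (C i)" for i j a
      by (rule target_arr[OF Yt that])
    \<comment> \<open>Two preimages of one arrow agree as soon as both are moved to a common stage.\<close>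
    have wd: "FArr (\<psi> i) a = FArr (\<psi> j) b"
      if ab: "a \<in> Arr (C i)" "b \<in> Arr (C j)" "FArr (\<phi> i) a = FArr (\<phi> j) b" for i j a b
    proof -
      define k where "k = max i j"
      have k: "i \<le> k" "j \<le> k" by (simp_all add: k_def)
      have "FArr (\<phi> k) (FArr (f i k) a) = FArr (\<phi> k) (FArr (f j k) b)"
        unfolding \<phi>f[OF k(1) ab(1)] \<phi>f[OF k(2) ab(2)] by (fact ab(3))
      then have "FArr (f i k) a = FArr (f j k) b"
        by (rule inj_onD[OF inj])
          (rule functor_arr(1)[OF f[OF k(1)] C ab(1)] functor_arr(1)[OF f[OF k(2)] C ab(2)])+
      then show ?thesis
        using \<psi>f[OF k(1) ab(1)] \<psi>f[OF k(2) ab(2)] by metis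
    qed
    \<comment> \<open>The arrow part of the extension; the object part is read off from identity arrows.\<close>
    define ua where "ua g = (SOME h. \<exists>i a. a \<in> Arr (C i) \<and> FArr (\<phi> i) a = g \<and> h = FArr (\<psi> i) a)" for g
    define u where "u = \<lparr>FObj = (\<lambda>x. Dom Y (ua (Ident X x))), FArr = ua\<rparr>"
    have ua: "FArr u (FArr (\<phi> i) a) = FArr (\<psi> i) a" if "a \<in> Arr (C i)" for i a
    proof -
      have "\<exists>i' a'. a' \<in> Arr (C i') \<and> FArr (\<phi> i') a' = FArr (\<phi> i) a \<and>
        ua (FArr (\<phi> i) a) = FArr (\<psi> i') a'"
        unfolding ua_def by (rule someI_ex) (use that in blast)
      then obtain i' a' where a': "a' \<in> Arr (C i')" "FArr (\<phi> i') a' = FArr (\<phi> i) a"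
        "ua (FArr (\<phi> i) a) = FArr (\<psi> i') a'" by blast
      have "FArr (\<psi> i') a' = FArr (\<psi> i) a" by (rule wd) (fact a' that)+
      then show ?thesis using a'(3) by (simp add: u_def)
    qed
    have uo: "FObj u (FObj (\<phi> i) x) = FObj (\<psi> i) x" if x: "x \<in> Obj (C i)" for i x
    proof -
      have "Ident X (FObj (\<phi> i) x) = FArr (\<phi> i) (Ident (C i) x)"
        using functor_obj(2)[OF \<phi> x] by simp
      then have "ua (Ident X (FObj (\<phi> i) x)) = FArr (\<psi> i) (Ident (C i) x)"
        using ua[OF category_ident(1)[OF C x]] by (simp add: u_def)
      then show ?thesis
        using functor_obj[OF \<psi> x] category_ident(2)[OF Y] by (simp add: u_def)
    qed
    have u: "is_functor X Y u"
    proof (rule is_functorI)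
      fix x assume "x \<in> Obj X"
      then obtain i a where a: "a \<in> Obj (C i)" "x = FObj (\<phi> i) a" using exh_obj by blast
      show "FObj u x \<in> Obj Y" using a uo functor_obj[OF \<psi>] by simp
      have "FArr u (Ident X x) = FArr u (FArr (\<phi> i) (Ident (C i) a))"
        using a functor_obj[OF \<phi>] by simp
      also have "\<dots> = Ident Y (FObj u x)"
        using a ua[OF category_ident(1)[OF C a(1)]] functor_obj[OF \<psi>] uo by simp
      finally show "FArr u (Ident X x) = Ident Y (FObj u x)" .
    next
      fix g assume "g \<in> Arr X"
      then obtain i a where a: "a \<in> Arr (C i)" "g = FArr (\<phi> i) a" using exh by blast
      show "FArr u g \<in> Arr Y \<and> Dom Y (FArr u g) = FObj u (Dom X g)
        \<and> Cod Y (FArr u g) = FObj u (Cod X g)"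
        using a ua functor_arr[OF \<psi> C] functor_arr[OF \<phi> C] uo category_arr[OF C] by simp
    next
      fix g h assume gh: "g \<in> Arr X" "h \<in> Arr X" "Cod X g = Dom X h"
      obtain i a where a: "a \<in> Arr (C i)" "g = FArr (\<phi> i) a" using exh gh(1) by blast
      obtain j b where b: "b \<in> Arr (C j)" "h = FArr (\<phi> j) b" using exh gh(2) by blast
      define k where "k = max i j"
      define a' where "a' = FArr (f i k) a"
      define b' where "b' = FArr (f j k) b"
      have a': "a' \<in> Arr (C k)" "g = FArr (\<phi> k) a'"
        using a functor_arr(1)[OF f C a(1)] \<phi>f by (auto simp: a'_def k_def)
      have b': "b' \<in> Arr (C k)" "h = FArr (\<phi> k) b'"
        using b functor_arr(1)[OF f C b(1)] \<phi>f by (auto simp: b'_def k_def)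
      have "Cod (C k) a' = Dom (C k) b'"
      proof (rule inj_obj)
        show "FObj (\<phi> k) (Cod (C k) a') = FObj (\<phi> k) (Dom (C k) b')"
          using gh(3) functor_arr(3)[OF \<phi> C a'(1)] functor_arr(2)[OF \<phi> C b'(1)]
          unfolding a'(2) b'(2) by simp
      qed (rule category_arr[OF C a'(1)] category_arr[OF C b'(1)])+
      then have ab: "a' \<in> Hom (C k) (Dom (C k) a') (Cod (C k) a')"
        "b' \<in> Hom (C k) (Cod (C k) a') (Cod (C k) b')"
        using a'(1) b'(1) by (auto simp: Hom_iff)
      have "Comp X h g = FArr (\<phi> k) (Comp (C k) b' a')"
        using functor_comp[OF \<phi> ab] a' b' by simp
      moreover have "Comp (C k) b' a' \<in> Arr (C k)"
        using category_comp[OF C ab] by (simp add: Hom_iff)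
      ultimately have "FArr u (Comp X h g) = FArr (\<psi> k) (Comp (C k) b' a')"
        using ua by simp
      then show "FArr u (Comp X h g) = Comp Y (FArr u h) (FArr u g)"
        using functor_comp[OF \<psi> ab] a' b' ua by simp
    qed
    have eq: "functor_eq X u u'"
      if u': "is_functor X Y u'" "\<And>i. functor_eq (C i) (\<psi> i) (u' \<circ>\<^sub>F \<phi> i)" for u'
      unfolding functor_eq_def
    proof (intro conjI ballI)
      fix x assume "x \<in> Obj X"
      then obtain i a where a: "a \<in> Obj (C i)" "x = FObj (\<phi> i) a" using exh_obj by blast
      then show "FObj u x = FObj u' x" using uo u'(2)[of i] by (simp add: functor_eq_def)
    next
      fix g assume "g \<in> Arr X"
      then obtain i a where a: "a \<in> Arr (C i)" "g = FArr (\<phi> i) a" using exh by blast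
      then show "FArr u g = FArr u' g" using ua u'(2)[of i] by (simp add: functor_eq_def)
    qed
    have "functor_eq (C i) (\<psi> i) (u \<circ>\<^sub>F \<phi> i)" for i
      using ua uo by (simp add: functor_eq_def)
    then show ?thesis
      using u by (intro exI[of _ u] conjI allI impI naturally_equivalent_of_eq[OF X Y u] eq) auto
  qed
  show ?thesis
    unfolding is_colimit_def using ds tgt univ by (intro conjI allI impI)
qed

section \<open>Modules and restriction of scalars\<close>

lemma finsum_eq_of_fields:
  assumes "carrier M = carrier N" "zero M = zero N" "add M = add N"
  shows "finsum M f A = finsum N f A"
  by (simp add: finsum_def finprod_def assms)

text \<open>
  Modules over different rings have different record types; this carries the additive group of one
  over to the other.
\<close>

lemma abelian_group_of_fields:
  assumes "abelian_group M" "carrier M = carrier N" "zero M = zero N" "add M = add N"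
  shows "abelian_group N"
  using assms(1) abelian_groupE[OF assms(1)]
  by (intro abelian_groupI) (simp_all add: assms(2-4)[symmetric])

context left_module
begin

lemma zero_smult:
  assumes "x \<in> carrier M"
  shows "\<zero> \<odot>\<^bsub>M\<^esub> x = \<zero>\<^bsub>M\<^esub>"
proof -
  have c: "\<zero> \<odot>\<^bsub>M\<^esub> x \<in> carrier M" by (rule smult_closed[OF R.zero_closed assms])
  have "\<zero> \<odot>\<^bsub>M\<^esub> x \<oplus>\<^bsub>M\<^esub> \<zero> \<odot>\<^bsub>M\<^esub> x = (\<zero> \<oplus> \<zero>) \<odot>\<^bsub>M\<^esub> x"
    by (rule smult_l_distr[OF R.zero_closed R.zero_closed assms, symmetric])
  also have "\<dots> = \<zero> \<odot>\<^bsub>M\<^esub> x" by simp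
  finally show ?thesis using M.add.l_cancel_one[OF c c] by simp
qed

lemma smult_zero:
  assumes "a \<in> carrier R"
  shows "a \<odot>\<^bsub>M\<^esub> \<zero>\<^bsub>M\<^esub> = \<zero>\<^bsub>M\<^esub>"
proof -
  have c: "a \<odot>\<^bsub>M\<^esub> \<zero>\<^bsub>M\<^esub> \<in> carrier M" by (rule smult_closed[OF assms M.zero_closed])
  have "a \<odot>\<^bsub>M\<^esub> \<zero>\<^bsub>M\<^esub> \<oplus>\<^bsub>M\<^esub> a \<odot>\<^bsub>M\<^esub> \<zero>\<^bsub>M\<^esub> = a \<odot>\<^bsub>M\<^esub> (\<zero>\<^bsub>M\<^esub> \<oplus>\<^bsub>M\<^esub> \<zero>\<^bsub>M\<^esub>)"
    by (rule smult_r_distr[OF assms M.zero_closed M.zero_closed, symmetric])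
  also have "\<dots> = a \<odot>\<^bsub>M\<^esub> \<zero>\<^bsub>M\<^esub>" by simp
  finally show ?thesis using M.add.l_cancel_one[OF c c] by simp
qed

lemma uminus_smult:
  assumes "a \<in> carrier R" "x \<in> carrier M"
  shows "(\<ominus> a) \<odot>\<^bsub>M\<^esub> x = \<ominus>\<^bsub>M\<^esub> (a \<odot>\<^bsub>M\<^esub> x)"
proof -
  have "(\<ominus> a) \<odot>\<^bsub>M\<^esub> x \<oplus>\<^bsub>M\<^esub> a \<odot>\<^bsub>M\<^esub> x = (\<ominus> a \<oplus> a) \<odot>\<^bsub>M\<^esub> x"
    by (rule smult_l_distr[OF R.a_inv_closed[OF assms(1)] assms, symmetric])
  also have "\<dots> = \<zero>\<^bsub>M\<^esub>"
    using zero_smult[OF assms(2)] assms(1) by (simp add: R.l_neg)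
  finally show ?thesis
    using assms by (intro M.minus_equality[symmetric]) (simp_all add: smult_closed)
qed

lemma minus_smult_eq_zero_iff:
  assumes "a \<in> carrier R" "b \<in> carrier R" "x \<in> carrier M"
  shows "(a \<ominus> b) \<odot>\<^bsub>M\<^esub> x = \<zero>\<^bsub>M\<^esub> \<longleftrightarrow> a \<odot>\<^bsub>M\<^esub> x = b \<odot>\<^bsub>M\<^esub> x"
proof -
  have "(a \<ominus> b) \<odot>\<^bsub>M\<^esub> x = a \<odot>\<^bsub>M\<^esub> x \<ominus>\<^bsub>M\<^esub> b \<odot>\<^bsub>M\<^esub> x"
    using assms by (simp add: a_minus_def smult_l_distr uminus_smult)
  moreover have "u \<ominus>\<^bsub>M\<^esub> v = \<zero>\<^bsub>M\<^esub> \<longleftrightarrow> u = v" if uv: "u \<in> carrier M" "v \<in> carrier M" for u v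
  proof
    assume "u \<ominus>\<^bsub>M\<^esub> v = \<zero>\<^bsub>M\<^esub>"
    then have "\<ominus>\<^bsub>M\<^esub> (\<ominus>\<^bsub>M\<^esub> v) = u"
      using uv by (intro M.minus_equality) (simp_all add: a_minus_def)
    then show "u = v" using uv by simp
  qed (use uv in \<open>simp add: a_minus_def M.r_neg\<close>)
  ultimately show ?thesis
    using assms by (simp add: smult_closed)
qed

lemma finsum_smult:
  assumes "finite A" "\<And>i. i \<in> A \<Longrightarrow> F i \<in> carrier R" "x \<in> carrier M"
  shows "(\<Oplus>i\<in>A. F i) \<odot>\<^bsub>M\<^esub> x = (\<Oplus>\<^bsub>M\<^esub>i\<in>A. F i \<odot>\<^bsub>M\<^esub> x)"
  using assms(1,2)
proof (induction A)
  case empty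
  then show ?case by (simp add: zero_smult assms(3))
next
  case (insert i A)
  have F: "F \<in> A \<rightarrow> carrier R" "F i \<in> carrier R" using insert.prems by auto
  have "(\<Oplus>i\<in>insert i A. F i) \<odot>\<^bsub>M\<^esub> x = (F i \<oplus> (\<Oplus>i\<in>A. F i)) \<odot>\<^bsub>M\<^esub> x"
    using insert.hyps F by simp
  also have "\<dots> = F i \<odot>\<^bsub>M\<^esub> x \<oplus>\<^bsub>M\<^esub> (\<Oplus>i\<in>A. F i) \<odot>\<^bsub>M\<^esub> x"
    by (rule smult_l_distr[OF F(2) R.add.finprod_closed[OF F(1)] assms(3)])
  also have "(\<Oplus>i\<in>A. F i) \<odot>\<^bsub>M\<^esub> x = (\<Oplus>\<^bsub>M\<^esub>i\<in>A. F i \<odot>\<^bsub>M\<^esub> x)"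
    using insert.IH insert.prems by simp
  also have "F i \<odot>\<^bsub>M\<^esub> x \<oplus>\<^bsub>M\<^esub> (\<Oplus>\<^bsub>M\<^esub>i\<in>A. F i \<odot>\<^bsub>M\<^esub> x) = (\<Oplus>\<^bsub>M\<^esub>i\<in>insert i A. F i \<odot>\<^bsub>M\<^esub> x)"
    using insert.hyps insert.prems assms(3)
    by (intro M.add.finprod_insert[symmetric]) (auto intro!: smult_closed)
  finally show ?case .
qed

definition annihilator :: "'r set" where
  "annihilator = {a \<in> carrier R. \<forall>x\<in>carrier M. a \<odot>\<^bsub>M\<^esub> x = \<zero>\<^bsub>M\<^esub>}"

text \<open>
  This is what reduces statements about the kernel of an algebra map to statements about generators
  of that kernel.
\<close>

lemma annihilator_ideal: "ideal annihilator R"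
proof (rule idealI)
  show "subgroup annihilator (add_monoid R)"
  proof
    show "inv\<^bsub>add_monoid R\<^esub> a \<in> annihilator" if "a \<in> annihilator" for a
      using that unfolding a_inv_def[symmetric] by (auto simp: annihilator_def uminus_smult)
  qed (auto simp: annihilator_def zero_smult smult_l_distr)
qed (auto simp: annihilator_def smult_assoc smult_zero smult_closed R.ring_axioms)

end

lemma Mod_cat_simps:
  "M \<in> Obj (Mod_cat R \<sigma>) \<longleftrightarrow> left_module R M \<and> normalized_module R M \<and> finite_dimensional \<sigma> M"
  "(M, f, N) \<in> Arr (Mod_cat R \<sigma>) \<longleftrightarrow>
     M \<in> Obj (Mod_cat R \<sigma>) \<and> N \<in> Obj (Mod_cat R \<sigma>) \<and> f \<in> module_hom R M N"
  "Dom (Mod_cat R \<sigma>) (M, f, N) = M" "Cod (Mod_cat R \<sigma>) (M, f, N) = N"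
  "Ident (Mod_cat R \<sigma>) M = (M, (\<lambda>x\<in>carrier M. x), M)"
  "Comp (Mod_cat R \<sigma>) (N', g, P) (M, f, N) = (M, compose (carrier M) g f, P)"
  by (simp_all add: Mod_cat_def)

lemma module_hom_comp:
  assumes "f \<in> module_hom R M N" "g \<in> module_hom R N P" "left_module R M"
  shows "compose (carrier M) g f \<in> module_hom R M P"
proof -
  interpret left_module R M by fact
  have f: "f x \<in> carrier N" if "x \<in> carrier M" for x
    using assms(1) that by (auto simp: module_hom_def)
  show ?thesis
    using assms(1,2) f by (auto simp: module_hom_def compose_def smult_closed PiE_iff)
qed

lemma module_hom_ident:
  assumes "left_module R M"
  shows "(\<lambda>x\<in>carrier M. x) \<in> module_hom R M M"
proof -
  interpret left_module R M by fact
  show ?thesis by (auto simp: module_hom_def smult_closed)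
qed

lemma Mod_cat_is_category: "is_category (Mod_cat R \<sigma>)" (is "is_category ?C")
  unfolding is_category_def
proof (intro conjI ballI allI impI)
  fix a assume "a \<in> Arr ?C"
  then show "Dom ?C a \<in> Obj ?C" "Cod ?C a \<in> Obj ?C"
    by (cases a; simp add: Mod_cat_simps)+
next
  fix M assume "M \<in> Obj ?C"
  then show "Ident ?C M \<in> Hom ?C M M"
    by (simp add: Hom_def Mod_cat_simps module_hom_ident)
next
  fix M N P a b
  assume "a \<in> Hom ?C M N \<and> b \<in> Hom ?C N P"
  then show "Comp ?C b a \<in> Hom ?C M P"
    by (cases a; cases b) (auto simp: Hom_def Mod_cat_simps intro: module_hom_comp)
next
  fix M N a assume "a \<in> Hom ?C M N"
  then show "Comp ?C a (Ident ?C M) = a"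
    and "Comp ?C (Ident ?C N) a = a"
    by (cases a; auto simp: Hom_def Mod_cat_simps module_hom_def compose_def PiE_iff
        extensional_def fun_eq_iff)+
next
  fix M N P O' a b c
  assume "a \<in> Hom ?C M N \<and> b \<in> Hom ?C N P \<and> c \<in> Hom ?C P O'"
  then show "Comp ?C c (Comp ?C b a)
      = Comp ?C (Comp ?C c b) a"
    by (cases a; cases b; cases c)
      (auto simp: Hom_def Mod_cat_simps module_hom_def compose_def PiE_iff fun_eq_iff)
qed

text \<open>
  Restriction of scalars from \<open>S\<close> to \<open>R\<close>, where \<open>\<sigma>\<close> and \<open>\<tau>\<close> are the structure maps of the two
  complex algebras. Surjectivity of \<open>h\<close> is what makes the functor full and injective on objects: every
  scalar of \<open>S\<close> is some \<open>h a\<close>, so its action can be read off from the action of \<open>a\<close>.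
\<close>

locale scalar_restriction =
  fixes R :: "('r, 'z) ring_scheme" and S :: "('s, 'y) ring_scheme" and h
    and \<sigma> :: "complex \<Rightarrow> 'r" and \<tau> :: "complex \<Rightarrow> 's"
  assumes ring_R: "ring R" and ring_S: "ring S" and hom: "h \<in> ring_hom R S"
    and surj: "h ` carrier R = carrier S"
    and scalar_closed: "\<sigma> c \<in> carrier R" and scalar: "h (\<sigma> c) = \<tau> c"
begin

lemma restrict_fields [simp]:
  "carrier (restrict_module R h M) = carrier M" "zero (restrict_module R h M) = zero M"
  "add (restrict_module R h M) = add M" "mult (restrict_module R h M) = mult M"
  "one (restrict_module R h M) = one M"
  by (simp_all add: restrict_module_def)

lemma restrict_smult:
  "\<lbrakk>a \<in> carrier R; x \<in> carrier M\<rbrakk> \<Longrightarrow> a \<odot>\<^bsub>restrict_module R h M\<^esub> x = h a \<odot>\<^bsub>M\<^esub> x"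
  "\<not> (a \<in> carrier R \<and> x \<in> carrier M) \<Longrightarrow> a \<odot>\<^bsub>restrict_module R h M\<^esub> x = undefined"
  by (auto simp: restrict_module_def)

lemma h_closed: "a \<in> carrier R \<Longrightarrow> h a \<in> carrier S"
  using hom by (rule ring_hom_closed)

lemma restrict_left_module:
  assumes "left_module S M"
  shows "left_module R (restrict_module R h M)"
proof -
  interpret M: left_module S M by fact
  interpret R: ring R by (rule ring_R)
  show ?thesis
  proof (intro left_module.intro left_module_axioms.intro ring_R)
    show "abelian_group (restrict_module R h M)"
      by (rule abelian_group_of_fields[OF M.M.abelian_group_axioms]) simp_all
    show "a \<odot>\<^bsub>restrict_module R h M\<^esub> x \<in> carrier (restrict_module R h M)"
      if "a \<in> carrier R" "x \<in> carrier (restrict_module R h M)" for a x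
      using that by (simp add: restrict_smult h_closed M.smult_closed)
    show "\<one>\<^bsub>R\<^esub> \<odot>\<^bsub>restrict_module R h M\<^esub> x = x" if "x \<in> carrier (restrict_module R h M)" for x
      using that by (simp add: restrict_smult ring_hom_one[OF hom] M.smult_one)
  qed (simp_all add: restrict_smult h_closed M.smult_closed ring_hom_add[OF hom]
      ring_hom_mult[OF hom] M.smult_l_distr M.smult_r_distr M.smult_assoc)
qed

lemma restrict_finite_dimensional:
  assumes "left_module S M"
  shows "finite_dimensional \<sigma> (restrict_module R h M) \<longleftrightarrow> finite_dimensional \<tau> M"
proof -
  interpret M: left_module S M by fact
  have \<tau>: "\<tau> c \<in> carrier S" for c
    using h_closed[OF scalar_closed] scalar by simp
  have "(\<Oplus>\<^bsub>restrict_module R h M\<^esub>b\<in>B. \<sigma> (c b) \<odot>\<^bsub>restrict_module R h M\<^esub> b)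
      = (\<Oplus>\<^bsub>M\<^esub>b\<in>B. \<tau> (c b) \<odot>\<^bsub>M\<^esub> b)" if B: "B \<subseteq> carrier M" for B c
  proof -
    have "(\<Oplus>\<^bsub>restrict_module R h M\<^esub>b\<in>B. \<sigma> (c b) \<odot>\<^bsub>restrict_module R h M\<^esub> b)
      = (\<Oplus>\<^bsub>M\<^esub>b\<in>B. \<sigma> (c b) \<odot>\<^bsub>restrict_module R h M\<^esub> b)"
      by (rule finsum_eq_of_fields) simp_all
    also have "\<dots> = (\<Oplus>\<^bsub>M\<^esub>b\<in>B. \<tau> (c b) \<odot>\<^bsub>M\<^esub> b)"
      using B by (intro M.M.add.finprod_cong')
        (auto simp: restrict_smult scalar_closed scalar \<tau> M.smult_closed subset_iff)
    finally show ?thesis .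
  qed
  then show ?thesis
    unfolding finite_dimensional_def restrict_fields by (simp cong: conj_cong)
qed

lemma restrict_obj:
  assumes "M \<in> Obj (Mod_cat S \<tau>)"
  shows "restrict_module R h M \<in> Obj (Mod_cat R \<sigma>)"
proof -
  have M: "left_module S M" "normalized_module S M" "finite_dimensional \<tau> M"
    using assms by (simp_all add: Mod_cat_simps)
  have "normalized_module R (restrict_module R h M)"
    using M(2) unfolding normalized_module_def by (auto simp: restrict_smult)
  then show ?thesis
    using restrict_left_module[OF M(1)] restrict_finite_dimensional[OF M(1)] M(3)
    by (simp add: Mod_cat_simps)
qed

lemma restrict_hom:
  "module_hom R (restrict_module R h M) (restrict_module R h N) = module_hom S M N"
  if "left_module S M"
proof -
  interpret M: left_module S M by fact
  have *: "(\<forall>a\<in>carrier R. \<forall>x\<in>carrier M.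
        f (a \<odot>\<^bsub>restrict_module R h M\<^esub> x) = a \<odot>\<^bsub>restrict_module R h N\<^esub> f x) \<longleftrightarrow>
      (\<forall>b\<in>carrier S. \<forall>x\<in>carrier M. f (b \<odot>\<^bsub>M\<^esub> x) = b \<odot>\<^bsub>N\<^esub> f x)"
    if f: "f \<in> carrier M \<rightarrow>\<^sub>E carrier N" for f
  proof -
    have "f x \<in> carrier N" if "x \<in> carrier M" for x using f that by auto
    then show ?thesis
      unfolding surj[symmetric] by (simp add: restrict_smult)
  qed
  show ?thesis
    unfolding module_hom_def restrict_fields by (rule Collect_cong) (use * in blast)
qed

text \<open>
  Strict injectivity, and not only up to isomorphism, depends on the normalization of modules:
  outside their domains all operations have the same fixed value.
\<close>

lemma restrict_inj:
  assumes "M \<in> Obj (Mod_cat S \<tau>)" "N \<in> Obj (Mod_cat S \<tau>)"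
    and eq: "restrict_module R h M = restrict_module R h N"
  shows "M = N"
proof -
  have nM: "normalized_module S M" and nN: "normalized_module S N"
    using assms by (simp_all add: Mod_cat_simps)
  have c: "carrier M = carrier N"
    using arg_cong[OF eq, of carrier] by simp
  have "b \<odot>\<^bsub>M\<^esub> x = b \<odot>\<^bsub>N\<^esub> x" for b x
  proof (cases "b \<in> carrier S \<and> x \<in> carrier M")
    case True
    then obtain a where "a \<in> carrier R" "b = h a" using surj by blast
    then show ?thesis
      using True c restrict_smult(1)[of a x M] restrict_smult(1)[of a x N] eq by simp
  next
    case False
    then show ?thesis
      using nM nN c by (auto simp: normalized_module_def)
  qed
  then have s: "smult M = smult N" by (intro ext)
  show ?thesis
    using c s arg_cong[OF eq, of zero] arg_cong[OF eq, of mult] arg_cong[OF eq, of one]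
      arg_cong[OF eq, of add]
    by (intro module.equality) simp_all
qed

text \<open>
  A scalar \<open>b\<close> of \<open>S\<close> acts as an arbitrarily chosen preimage of \<open>b\<close>; by hypothesis all preimages act
  in the same way, so the module axioms can be checked on preimages.
\<close>

lemma descend_obj:
  assumes N: "N \<in> Obj (Mod_cat R \<sigma>)"
    and ker: "\<And>a b x. \<lbrakk>a \<in> carrier R; b \<in> carrier R; h a = h b; x \<in> carrier N\<rbrakk> \<Longrightarrow>
      a \<odot>\<^bsub>N\<^esub> x = b \<odot>\<^bsub>N\<^esub> x"
  obtains M where "M \<in> Obj (Mod_cat S \<tau>)" "restrict_module R h M = N"
proof -
  have N': "left_module R N" "normalized_module R N" "finite_dimensional \<sigma> N"
    using N by (simp_all add: Mod_cat_simps)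
  interpret N: left_module R N by fact
  define M where "M = \<lparr>carrier = carrier N, mult = mult N, one = one N, zero = zero N, add = add N,
    smult = (\<lambda>b x. if b \<in> carrier S \<and> x \<in> carrier N
      then (SOME a. a \<in> carrier R \<and> h a = b) \<odot>\<^bsub>N\<^esub> x else undefined)\<rparr>"
  have fields: "carrier M = carrier N" "mult M = mult N" "one M = one N" "zero M = zero N"
    "add M = add N"
    by (simp_all add: M_def)
  have smult: "h a \<odot>\<^bsub>M\<^esub> x = a \<odot>\<^bsub>N\<^esub> x" if a: "a \<in> carrier R" and x: "x \<in> carrier N" for a x
  proof -
    have "(SOME a'. a' \<in> carrier R \<and> h a' = h a) \<in> carrier R \<and>
        h (SOME a'. a' \<in> carrier R \<and> h a' = h a) = h a"
      by (rule someI) (use a in blast)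
    then have "(SOME a'. a' \<in> carrier R \<and> h a' = h a) \<odot>\<^bsub>N\<^esub> x = a \<odot>\<^bsub>N\<^esub> x"
      using ker a x by blast
    then show ?thesis using a x h_closed by (simp add: M_def)
  qed
  have lift: "\<exists>a. a \<in> carrier R \<and> b = h a" if "b \<in> carrier S" for b
    using that surj by blast
  have M: "left_module S M"
  proof (intro left_module.intro left_module_axioms.intro ring_S)
    show "abelian_group M"
      by (rule abelian_group_of_fields[OF N.M.abelian_group_axioms]) (simp_all add: fields)
  next
    fix b x assume "b \<in> carrier S" "x \<in> carrier M"
    then show "b \<odot>\<^bsub>M\<^esub> x \<in> carrier M"
      using lift[of b] by (auto simp: fields smult N.smult_closed)
  next
    fix b c x assume "b \<in> carrier S" "c \<in> carrier S" and x: "x \<in> carrier M"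
    then obtain a d where ad: "a \<in> carrier R" "b = h a" "d \<in> carrier R" "c = h d"
      using lift by blast
    show "(b \<oplus>\<^bsub>S\<^esub> c) \<odot>\<^bsub>M\<^esub> x = b \<odot>\<^bsub>M\<^esub> x \<oplus>\<^bsub>M\<^esub> c \<odot>\<^bsub>M\<^esub> x"
      using ad x by (simp add: fields smult N.smult_closed N.smult_l_distr
          ring_hom_add[OF hom, symmetric])
    show "(b \<otimes>\<^bsub>S\<^esub> c) \<odot>\<^bsub>M\<^esub> x = b \<odot>\<^bsub>M\<^esub> (c \<odot>\<^bsub>M\<^esub> x)"
      using ad x by (simp add: fields smult N.smult_closed N.smult_assoc
          ring_hom_mult[OF hom, symmetric])
  next
    fix b x y assume "b \<in> carrier S" and xy: "x \<in> carrier M" "y \<in> carrier M"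
    then obtain a where "a \<in> carrier R" "b = h a" using lift by blast
    then show "b \<odot>\<^bsub>M\<^esub> (x \<oplus>\<^bsub>M\<^esub> y) = b \<odot>\<^bsub>M\<^esub> x \<oplus>\<^bsub>M\<^esub> b \<odot>\<^bsub>M\<^esub> y"
      using xy by (simp add: fields smult N.smult_r_distr)
  next
    fix x assume "x \<in> carrier M"
    then show "\<one>\<^bsub>S\<^esub> \<odot>\<^bsub>M\<^esub> x = x"
      by (simp add: fields smult N.smult_one ring_hom_one[OF hom, symmetric])
  qed
  have res: "restrict_module R h M = N"
  proof (intro module.equality)
    have "a \<odot>\<^bsub>restrict_module R h M\<^esub> x = a \<odot>\<^bsub>N\<^esub> x" for a x
      using N'(2) by (cases "a \<in> carrier R \<and> x \<in> carrier N")
        (auto simp: restrict_smult fields smult normalized_module_def)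
    then show "smult (restrict_module R h M) = smult N" by (intro ext)
  qed (simp_all add: fields)
  have "normalized_module S M"
    using N'(2) unfolding normalized_module_def fields by (simp add: M_def)
  moreover have "finite_dimensional \<tau> M"
    using restrict_finite_dimensional[OF M] N'(3) res by simp
  ultimately show thesis
    using that M res by (simp add: Mod_cat_simps)
qed

lemma restriction_is_functor:
  "is_functor (Mod_cat S \<tau>) (Mod_cat R \<sigma>) (restriction_functor R h)"
    (is "is_functor ?S ?R ?F")
  unfolding is_functor_def
proof (intro conjI ballI allI impI)
  fix M assume "M \<in> Obj ?S"
  then show "FObj ?F M \<in> Obj ?R"
    by (simp add: restriction_functor_def restrict_obj)
next
  fix M N a assume "a \<in> Hom ?S M N"
  then obtain f where f: "a = (M, f, N)" "(M, f, N) \<in> Arr ?S"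
    by (cases a) (auto simp: Hom_def Mod_cat_simps(3,4))
  then show "FArr ?F a
      \<in> Hom ?R (FObj ?F M) (FObj ?F N)"
    using restrict_hom[of M N] restrict_obj[of M] restrict_obj[of N]
    by (simp add: Hom_def restriction_functor_def Mod_cat_simps)
next
  fix M N P a b assume "a \<in> Hom ?S M N \<and> b \<in> Hom ?S N P"
  then show "FArr ?F (Comp ?S b a) =
    Comp ?R (FArr ?F b) (FArr ?F a)"
    by (cases a; cases b) (auto simp: restriction_functor_def Mod_cat_simps)
qed (simp add: restriction_functor_def Mod_cat_simps)

lemma restriction_inj_on_arr:
  "inj_on (FArr (restriction_functor R h)) (Arr (Mod_cat S \<tau>))"
    (is "inj_on (FArr ?F) (Arr ?S)")
proof (rule inj_onI)
  fix a b assume ab: "a \<in> Arr ?S" "b \<in> Arr ?S"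
    "FArr ?F a = FArr ?F b"
  obtain M f N where a: "a = (M, f, N)" by (cases a)
  obtain M' f' N' where b: "b = (M', f', N')" by (cases b)
  show "a = b"
    using ab restrict_inj[of M M'] restrict_inj[of N N']
    unfolding a b by (simp add: restriction_functor_def Mod_cat_simps(2))
qed

lemma arr_in_image:
  assumes "M \<in> Obj (Mod_cat S \<tau>)" "N \<in> Obj (Mod_cat S \<tau>)"
    and "(restrict_module R h M, f, restrict_module R h N) \<in> Arr (Mod_cat R \<sigma>)"
  shows "(restrict_module R h M, f, restrict_module R h N)
    \<in> FArr (restriction_functor R h) ` Arr (Mod_cat S \<tau>)"
proof -
  have "(M, f, N) \<in> Arr (Mod_cat S \<tau>)"
    using assms restrict_hom[of M N] by (simp add: Mod_cat_simps)
  moreover have "FArr (restriction_functor R h) (M, f, N)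
      = (restrict_module R h M, f, restrict_module R h N)"
    by (simp add: restriction_functor_def)
  ultimately show ?thesis by (intro image_eqI[where x = "(M, f, N)"]) simp_all
qed

end

lemma restrict_module_cong:
  assumes "\<And>a. a \<in> carrier R \<Longrightarrow> h a = k a"
  shows "restrict_module R h M = restrict_module R k M"
proof -
  have "(\<lambda>a x. if a \<in> carrier R \<and> x \<in> carrier M then h a \<odot>\<^bsub>M\<^esub> x else undefined) =
      (\<lambda>a x. if a \<in> carrier R \<and> x \<in> carrier M then k a \<odot>\<^bsub>M\<^esub> x else undefined)"
    using assms by (intro ext) simp
  then show ?thesis
    unfolding restrict_module_def by (rule arg_cong)
qed

lemma restrict_module_comp:
  assumes "\<And>a. a \<in> carrier R \<Longrightarrow> h a \<in> carrier S"
  shows "restrict_module R h (restrict_module S k M) = restrict_module R (\<lambda>a. k (h a)) M"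
proof (intro module.equality)
  show "smult (restrict_module R h (restrict_module S k M)) = smult (restrict_module R (\<lambda>a. k (h a)) M)"
    using assms by (intro ext) (simp add: restrict_module_def)
qed (simp_all add: restrict_module_def)

text \<open>
  A map out of \<open>S\<close> is a homomorphism as soon as its composite with a surjective homomorphism onto \<open>S\<close>
  is one. This gives the homomorphism property of maps between quotients without computing with
  cosets.
\<close>

lemma ring_hom_factor:
  assumes p: "p \<in> ring_hom R S" "p ` carrier R = carrier S" and q: "q \<in> ring_hom R T"
    and r: "\<And>a. a \<in> carrier R \<Longrightarrow> r (p a) = q a" and "ring R"
  shows "r \<in> ring_hom S T"
proof -
  interpret ring R by fact
  have lift: "\<exists>a. a \<in> carrier R \<and> p a = b" if b: "b \<in> carrier S" for b
    using b unfolding p(2)[symmetric] by blast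
  show ?thesis
  proof (rule ring_hom_memI)
    fix b assume "b \<in> carrier S"
    from lift[OF this] obtain a where a: "a \<in> carrier R" "p a = b" by blast
    show "r b \<in> carrier T"
      using ring_hom_closed[OF q a(1)] unfolding a(2)[symmetric] r[OF a(1)] .
  next
    fix b c assume b: "b \<in> carrier S" and c: "c \<in> carrier S"
    from lift[OF b] obtain a where a: "a \<in> carrier R" "p a = b" by blast
    from lift[OF c] obtain d where d: "d \<in> carrier R" "p d = c" by blast
    show "r (b \<otimes>\<^bsub>S\<^esub> c) = r b \<otimes>\<^bsub>T\<^esub> r c"
      unfolding a(2)[symmetric] d(2)[symmetric] ring_hom_mult[OF p(1) a(1) d(1), symmetric]
        r[OF a(1)] r[OF d(1)] r[OF m_closed[OF a(1) d(1)]]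
      by (rule ring_hom_mult[OF q a(1) d(1)])
    show "r (b \<oplus>\<^bsub>S\<^esub> c) = r b \<oplus>\<^bsub>T\<^esub> r c"
      unfolding a(2)[symmetric] d(2)[symmetric] ring_hom_add[OF p(1) a(1) d(1), symmetric]
        r[OF a(1)] r[OF d(1)] r[OF add.m_closed[OF a(1) d(1)]]
      by (rule ring_hom_add[OF q a(1) d(1)])
  next
    show "r \<one>\<^bsub>S\<^esub> = \<one>\<^bsub>T\<^esub>"
      unfolding ring_hom_one[OF p(1), symmetric] r[OF one_closed] by (rule ring_hom_one[OF q])
  qed
qed

section \<open>Path algebras are rings\<close>

lemma mem_paths:
  "(u, es, v) \<in> paths Q \<longleftrightarrow> u \<in> verts Q \<and> set es \<subseteq> arcs Q \<and> pre_digraph.cas Q u es v"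
  by (simp add: paths_def pre_digraph.awalk_def)

lemma cas_append:
  "pre_digraph.cas Q u (es @ fs) w \<longleftrightarrow> (\<exists>v. pre_digraph.cas Q u es v \<and> pre_digraph.cas Q v fs w)"
  by (induction es arbitrary: u) (simp_all add: pre_digraph.cas.simps)

lemma cas_target_in_verts:
  assumes "wf_digraph Q" "u \<in> verts Q" "set es \<subseteq> arcs Q" "pre_digraph.cas Q u es v"
  shows "v \<in> verts Q"
  using assms(2-4)
proof (induction es arbitrary: u)
  case (Cons a es)
  then show ?case
    using Cons.IH[of "head Q a"] wf_digraph.head_in_verts[OF assms(1), of a]
    by (simp add: pre_digraph.cas.simps)
qed (simp add: pre_digraph.cas.simps)

lemma path_target_in_verts:
  assumes "wf_digraph Q" "(u, es, v) \<in> paths Q"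
  shows "v \<in> verts Q"
  using assms cas_target_in_verts by (auto simp: mem_paths)

lemma path_product_eq_Some:
  "path_product p q = Some r \<longleftrightarrow>
     (\<exists>u v w es fs. p = (v, es, w) \<and> q = (u, fs, v) \<and> r = (u, fs @ es, w))"
  by (cases p; cases q; cases r) auto

lemma path_product_in_paths:
  assumes "p \<in> paths Q" "q \<in> paths Q" "path_product p q = Some r"
  shows "r \<in> paths Q"
  using assms by (auto simp: path_product_eq_Some mem_paths cas_append)

lemma path_product_assoc:
  "(\<exists>s. path_product p q = Some s \<and> path_product s t = Some r) \<longleftrightarrow>
   (\<exists>s. path_product q t = Some s \<and> path_product p s = Some r)"
  by (cases p; cases q; cases t) auto

lemma path_algebra_simps:
  "f \<in> carrier (path_algebra Q) \<longleftrightarrow> finite {p. f p \<noteq> 0} \<and> {p. f p \<noteq> 0} \<subseteq> paths Q"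
  "\<zero>\<^bsub>path_algebra Q\<^esub> = (\<lambda>p. 0)"
  "f \<oplus>\<^bsub>path_algebra Q\<^esub> g = (\<lambda>p. f p + g p)"
  "\<one>\<^bsub>path_algebra Q\<^esub> = (\<lambda>p. if p \<in> (\<lambda>x. (x, [], x)) ` verts Q then 1 else 0)"
  by (simp_all add: path_algebra_def)

lemma sum_rotate:
  "(\<Sum>s\<in>S. \<Sum>a\<in>A. \<Sum>b\<in>B. F s a b) = (\<Sum>a\<in>A. \<Sum>b\<in>B. \<Sum>s\<in>S. F s a b)"
  for F :: "'a \<Rightarrow> 'b \<Rightarrow> 'c \<Rightarrow> 'd::comm_monoid_add"
  by (subst sum.swap, rule sum.cong[OF refl], rule sum.swap)

text \<open>
  The defining sum of the product runs over a set that depends on the supports of the factors and on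
  \<open>r\<close>. Summing over any finite sets that contain the supports allows several products to be compared
  over the same index sets.
\<close>

lemma path_mult_eq:
  assumes fin: "finite A" "finite B" and sub: "{p. f p \<noteq> 0} \<subseteq> A" "{q. g q \<noteq> 0} \<subseteq> B"
  shows "(f \<otimes>\<^bsub>path_algebra Q\<^esub> g) r =
    (\<Sum>p\<in>A. \<Sum>q\<in>B. if path_product p q = Some r then f p * g q else 0)"
proof -
  let ?T = "{(p, q). f p \<noteq> 0 \<and> g q \<noteq> 0 \<and> path_product p q = Some r}"
  have "(f \<otimes>\<^bsub>path_algebra Q\<^esub> g) r = (\<Sum>(p, q)\<in>?T. f p * g q)"
    by (simp add: path_algebra_def)
  also have "\<dots> = (\<Sum>(p, q)\<in>A \<times> B. if path_product p q = Some r then f p * g q else 0)"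
    by (rule sum.mono_neutral_cong_left) (use fin sub in \<open>auto split: if_splits\<close>)
  also have "\<dots> = (\<Sum>p\<in>A. \<Sum>q\<in>B. if path_product p q = Some r then f p * g q else 0)"
    by (rule sum.cartesian_product[symmetric])
  finally show ?thesis .
qed

lemma path_mult_support:
  assumes "(f \<otimes>\<^bsub>path_algebra Q\<^esub> g) r \<noteq> 0"
  obtains p q where "f p \<noteq> 0" "g q \<noteq> 0" "path_product p q = Some r"
proof -
  let ?T = "{(p, q). f p \<noteq> 0 \<and> g q \<noteq> 0 \<and> path_product p q = Some r}"
  have "(f \<otimes>\<^bsub>path_algebra Q\<^esub> g) r = (\<Sum>(p, q)\<in>?T. f p * g q)"
    by (simp add: path_algebra_def)
  then have "?T \<noteq> {}" using assms by (metis (no_types, lifting) sum.empty)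
  then show thesis using that by blast
qed

lemma path_mult_support_subset:
  "{r. (f \<otimes>\<^bsub>path_algebra Q\<^esub> g) r \<noteq> 0}
    \<subseteq> (\<lambda>(p, q). the (path_product p q)) ` ({p. f p \<noteq> 0} \<times> {q. g q \<noteq> 0})"
proof
  fix r assume "r \<in> {r. (f \<otimes>\<^bsub>path_algebra Q\<^esub> g) r \<noteq> 0}"
  then have "(f \<otimes>\<^bsub>path_algebra Q\<^esub> g) r \<noteq> 0" by simp
  then obtain p q where "f p \<noteq> 0" "g q \<noteq> 0" "path_product p q = Some r"
    by (rule path_mult_support)
  then show "r \<in> (\<lambda>(p, q). the (path_product p q)) ` ({p. f p \<noteq> 0} \<times> {q. g q \<noteq> 0})"
    by (intro image_eqI[where x = "(p, q)"]) auto
qed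

lemma path_mult_closed:
  assumes "f \<in> carrier (path_algebra Q)" "g \<in> carrier (path_algebra Q)"
  shows "f \<otimes>\<^bsub>path_algebra Q\<^esub> g \<in> carrier (path_algebra Q)"
proof -
  have "finite {r. (f \<otimes>\<^bsub>path_algebra Q\<^esub> g) r \<noteq> 0}"
    by (rule finite_subset[OF path_mult_support_subset])
      (use assms in \<open>auto simp: path_algebra_simps\<close>)
  moreover have "{r. (f \<otimes>\<^bsub>path_algebra Q\<^esub> g) r \<noteq> 0} \<subseteq> paths Q"
  proof
    fix r assume "r \<in> {r. (f \<otimes>\<^bsub>path_algebra Q\<^esub> g) r \<noteq> 0}"
    then have "(f \<otimes>\<^bsub>path_algebra Q\<^esub> g) r \<noteq> 0" by simp
    then obtain p q where pq: "f p \<noteq> 0" "g q \<noteq> 0" "path_product p q = Some r"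
      by (rule path_mult_support)
    have "p \<in> paths Q" "q \<in> paths Q"
      using pq assms by (auto simp: path_algebra_simps)
    then show "r \<in> paths Q" using pq(3) by (rule path_product_in_paths)
  qed
  ultimately show ?thesis by (simp add: path_algebra_simps)
qed

text \<open>
  Both sides are the sum of \<open>f a * g b * h c\<close> over all triples of paths whose product is \<open>r\<close>. The sum
  over the intermediate product \<open>s\<close> collapses, since it is determined by the two paths
  that are multiplied.
\<close>

lemma path_mult_assoc:
  assumes "f \<in> carrier (path_algebra Q)" "g \<in> carrier (path_algebra Q)"
    "h \<in> carrier (path_algebra Q)"
  shows "f \<otimes>\<^bsub>path_algebra Q\<^esub> g \<otimes>\<^bsub>path_algebra Q\<^esub> h
    = f \<otimes>\<^bsub>path_algebra Q\<^esub> (g \<otimes>\<^bsub>path_algebra Q\<^esub> h)"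
proof
  fix r
  define A B C where "A = {p. f p \<noteq> 0}" and "B = {p. g p \<noteq> 0}" and "C = {p. h p \<noteq> 0}"
  have fin: "finite A" "finite B" "finite C"
    using assms by (simp_all add: A_def B_def C_def path_algebra_simps)
  define S where "S = (\<lambda>(p, q). the (path_product p q)) ` (A \<times> B)"
  define T where "T = (\<lambda>(p, q). the (path_product p q)) ` (B \<times> C)"
  have finST: "finite S" "finite T" using fin by (simp_all add: S_def T_def)
  have S: "{p. (f \<otimes>\<^bsub>path_algebra Q\<^esub> g) p \<noteq> 0} \<subseteq> S"
    unfolding S_def A_def B_def by (rule path_mult_support_subset)
  have T: "{p. (g \<otimes>\<^bsub>path_algebra Q\<^esub> h) p \<noteq> 0} \<subseteq> T"
    unfolding T_def B_def C_def by (rule path_mult_support_subset)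
  have memS: "s \<in> S" if "path_product a b = Some s" "a \<in> A" "b \<in> B" for a b s
    unfolding S_def using that by (intro image_eqI[where x = "(a, b)"]) auto
  have memT: "s \<in> T" if "path_product a b = Some s" "a \<in> B" "b \<in> C" for a b s
    unfolding T_def using that by (intro image_eqI[where x = "(a, b)"]) auto
  have fg: "(f \<otimes>\<^bsub>path_algebra Q\<^esub> g) s =
      (\<Sum>a\<in>A. \<Sum>b\<in>B. if path_product a b = Some s then f a * g b else 0)" for s
    by (rule path_mult_eq) (simp_all add: fin A_def[symmetric] B_def[symmetric])
  have gh: "(g \<otimes>\<^bsub>path_algebra Q\<^esub> h) s =
      (\<Sum>a\<in>B. \<Sum>b\<in>C. if path_product a b = Some s then g a * h b else 0)" for s
    by (rule path_mult_eq) (simp_all add: fin B_def[symmetric] C_def[symmetric])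
  have "(f \<otimes>\<^bsub>path_algebra Q\<^esub> g \<otimes>\<^bsub>path_algebra Q\<^esub> h) r =
      (\<Sum>s\<in>S. \<Sum>c\<in>C. if path_product s c = Some r
        then (f \<otimes>\<^bsub>path_algebra Q\<^esub> g) s * h c else 0)"
    by (rule path_mult_eq[OF finST(1) fin(3) S]) (simp add: C_def)
  also have "\<dots> = (\<Sum>s\<in>S. \<Sum>c\<in>C. \<Sum>a\<in>A. \<Sum>b\<in>B.
      if path_product a b = Some s \<and> path_product s c = Some r then f a * g b * h c else 0)"
    unfolding fg by (intro sum.cong refl) (auto simp: sum_distrib_right intro!: sum.cong)
  also have "\<dots> = (\<Sum>c\<in>C. \<Sum>s\<in>S. \<Sum>a\<in>A. \<Sum>b\<in>B.
      if path_product a b = Some s \<and> path_product s c = Some r then f a * g b * h c else 0)"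
    by (rule sum.swap)
  also have "\<dots> = (\<Sum>c\<in>C. \<Sum>a\<in>A. \<Sum>b\<in>B. \<Sum>s\<in>S.
      if path_product a b = Some s \<and> path_product s c = Some r then f a * g b * h c else 0)"
    by (rule sum.cong[OF refl]) (rule sum_rotate)
  also have "\<dots> = (\<Sum>c\<in>C. \<Sum>a\<in>A. \<Sum>b\<in>B.
      if (\<exists>s. path_product a b = Some s \<and> path_product s c = Some r)
      then f a * g b * h c else 0)"
  proof (intro sum.cong refl)
    fix c a b assume "a \<in> A" "b \<in> B"
    show "(\<Sum>s\<in>S. if path_product a b = Some s \<and> path_product s c = Some r
          then f a * g b * h c else 0) =
        (if (\<exists>s. path_product a b = Some s \<and> path_product s c = Some r)
          then f a * g b * h c else 0)"
    proof (cases "path_product a b")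
      case (Some t)
      have "(\<Sum>s\<in>S. if path_product a b = Some s \<and> path_product s c = Some r
          then f a * g b * h c else 0) = (\<Sum>s\<in>S. if t = s then
            (if path_product t c = Some r then f a * g b * h c else 0) else 0)"
        unfolding Some by (intro sum.cong refl) auto
      also have "\<dots> = (if path_product t c = Some r then f a * g b * h c else 0)"
        using memS[OF Some \<open>a \<in> A\<close> \<open>b \<in> B\<close>] finST(1) by (subst sum.delta') simp_all
      finally show ?thesis unfolding Some by simp
    qed simp
  qed
  also have "\<dots> = (\<Sum>a\<in>A. \<Sum>b\<in>B. \<Sum>c\<in>C.
      if (\<exists>s. path_product a b = Some s \<and> path_product s c = Some r)
      then f a * g b * h c else 0)"
    by (rule sum_rotate)
  finally have left: "(f \<otimes>\<^bsub>path_algebra Q\<^esub> g \<otimes>\<^bsub>path_algebra Q\<^esub> h) r = \<dots>" .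
  have "(f \<otimes>\<^bsub>path_algebra Q\<^esub> (g \<otimes>\<^bsub>path_algebra Q\<^esub> h)) r =
      (\<Sum>a\<in>A. \<Sum>t\<in>T. if path_product a t = Some r
        then f a * (g \<otimes>\<^bsub>path_algebra Q\<^esub> h) t else 0)"
    by (rule path_mult_eq[OF fin(1) finST(2) _ T]) (simp add: A_def)
  also have "\<dots> = (\<Sum>a\<in>A. \<Sum>t\<in>T. \<Sum>b\<in>B. \<Sum>c\<in>C.
      if path_product b c = Some t \<and> path_product a t = Some r then f a * g b * h c else 0)"
    unfolding gh by (intro sum.cong refl) (auto simp: sum_distrib_left mult.assoc intro!: sum.cong)
  also have "\<dots> = (\<Sum>a\<in>A. \<Sum>b\<in>B. \<Sum>c\<in>C. \<Sum>t\<in>T.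
      if path_product b c = Some t \<and> path_product a t = Some r then f a * g b * h c else 0)"
    by (rule sum.cong[OF refl]) (rule sum_rotate)
  also have "\<dots> = (\<Sum>a\<in>A. \<Sum>b\<in>B. \<Sum>c\<in>C.
      if (\<exists>s. path_product a b = Some s \<and> path_product s c = Some r)
      then f a * g b * h c else 0)"
  proof (intro sum.cong refl)
    fix a b c assume "b \<in> B" "c \<in> C"
    show "(\<Sum>t\<in>T. if path_product b c = Some t \<and> path_product a t = Some r
          then f a * g b * h c else 0) =
        (if (\<exists>s. path_product a b = Some s \<and> path_product s c = Some r)
          then f a * g b * h c else 0)"
      unfolding path_product_assoc
    proof (cases "path_product b c")
      case (Some t)
      have "(\<Sum>s\<in>T. if path_product b c = Some s \<and> path_product a s = Some r
          then f a * g b * h c else 0) = (\<Sum>s\<in>T. if t = s then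
            (if path_product a t = Some r then f a * g b * h c else 0) else 0)"
        unfolding Some by (intro sum.cong refl) auto
      also have "\<dots> = (if path_product a t = Some r then f a * g b * h c else 0)"
        using memT[OF Some \<open>b \<in> B\<close> \<open>c \<in> C\<close>] finST(2) by (subst sum.delta') simp_all
      finally show "(\<Sum>t\<in>T. if path_product b c = Some t \<and> path_product a t = Some r
          then f a * g b * h c else 0) =
        (if (\<exists>s. path_product b c = Some s \<and> path_product a s = Some r)
          then f a * g b * h c else 0)" unfolding Some by simp
    qed simp
  qed
  finally show "(f \<otimes>\<^bsub>path_algebra Q\<^esub> g \<otimes>\<^bsub>path_algebra Q\<^esub> h) r
    = (f \<otimes>\<^bsub>path_algebra Q\<^esub> (g \<otimes>\<^bsub>path_algebra Q\<^esub> h)) r"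
    unfolding left by simp
qed

lemma path_mult_add:
  assumes "finite {p. f p \<noteq> 0}" "finite {p. g p \<noteq> 0}" "finite {p. h p \<noteq> 0}"
  shows "(\<lambda>p. f p + g p) \<otimes>\<^bsub>path_algebra Q\<^esub> h =
      (\<lambda>r. (f \<otimes>\<^bsub>path_algebra Q\<^esub> h) r + (g \<otimes>\<^bsub>path_algebra Q\<^esub> h) r)"
    and "h \<otimes>\<^bsub>path_algebra Q\<^esub> (\<lambda>p. f p + g p) =
      (\<lambda>r. (h \<otimes>\<^bsub>path_algebra Q\<^esub> f) r + (h \<otimes>\<^bsub>path_algebra Q\<^esub> g) r)"
proof -
  define A where "A = {p. f p \<noteq> 0} \<union> {p. g p \<noteq> 0}"
  define B where "B = {p. h p \<noteq> 0}"
  have fin: "finite A" "finite B" using assms by (simp_all add: A_def B_def)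
  have sub: "{p. f p \<noteq> 0} \<subseteq> A" "{p. g p \<noteq> 0} \<subseteq> A" "{p. f p + g p \<noteq> 0} \<subseteq> A" "{p. h p \<noteq> 0} \<subseteq> B"
    by (auto simp: A_def B_def)
  show "(\<lambda>p. f p + g p) \<otimes>\<^bsub>path_algebra Q\<^esub> h =
      (\<lambda>r. (f \<otimes>\<^bsub>path_algebra Q\<^esub> h) r + (g \<otimes>\<^bsub>path_algebra Q\<^esub> h) r)"
    unfolding path_mult_eq[OF fin sub(1,4)] path_mult_eq[OF fin sub(2,4)]
    by (rule ext, subst path_mult_eq[OF fin sub(3,4)])
      (auto simp: sum.distrib[symmetric] distrib_right intro!: sum.cong)
  show "h \<otimes>\<^bsub>path_algebra Q\<^esub> (\<lambda>p. f p + g p) =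
      (\<lambda>r. (h \<otimes>\<^bsub>path_algebra Q\<^esub> f) r + (h \<otimes>\<^bsub>path_algebra Q\<^esub> g) r)"
    unfolding path_mult_eq[OF fin(2,1) sub(4,1)] path_mult_eq[OF fin(2,1) sub(4,2)]
    by (rule ext, subst path_mult_eq[OF fin(2,1) sub(4,3)])
      (auto simp: sum.distrib[symmetric] distrib_left intro!: sum.cong)
qed

lemma path_mult_scale:
  assumes "finite {p. f p \<noteq> 0}" "finite {p. g p \<noteq> 0}"
  shows "(\<lambda>p. c * f p) \<otimes>\<^bsub>path_algebra Q\<^esub> g = (\<lambda>r. c * (f \<otimes>\<^bsub>path_algebra Q\<^esub> g) r)"
proof
  fix r
  have sub: "{p. c * f p \<noteq> 0} \<subseteq> {p. f p \<noteq> 0}" by auto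
  show "((\<lambda>p. c * f p) \<otimes>\<^bsub>path_algebra Q\<^esub> g) r = c * (f \<otimes>\<^bsub>path_algebra Q\<^esub> g) r"
    unfolding path_mult_eq[OF assms sub order_refl] path_mult_eq[OF assms order_refl order_refl]
      sum_distrib_left
    by (intro sum.cong refl) simp
qed

lemma path_one_mult:
  assumes "wf_digraph Q" "finite (verts Q)" "f \<in> carrier (path_algebra Q)"
  shows "\<one>\<^bsub>path_algebra Q\<^esub> \<otimes>\<^bsub>path_algebra Q\<^esub> f = f"
    and "f \<otimes>\<^bsub>path_algebra Q\<^esub> \<one>\<^bsub>path_algebra Q\<^esub> = f"
proof -
  define A :: "('a, 'b) path set" where "A = (\<lambda>x. (x, [], x)) ` verts Q"
  define B where "B = {p. f p \<noteq> 0}"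
  have fin: "finite A" "finite B" using assms by (simp_all add: A_def B_def path_algebra_simps)
  have sub: "{p. \<one>\<^bsub>path_algebra Q\<^esub> p \<noteq> 0} \<subseteq> A" "{p. f p \<noteq> 0} \<subseteq> B"
    by (auto simp: A_def B_def path_algebra_simps)
  have one: "\<one>\<^bsub>path_algebra Q\<^esub> p = 1" if "p \<in> A" for p
    using that by (simp add: A_def path_algebra_simps)
  have B: "B \<subseteq> paths Q" using assms(3) by (simp add: B_def path_algebra_simps)
  have left: "(\<Sum>p\<in>A. if path_product p q = Some r then \<one>\<^bsub>path_algebra Q\<^esub> p * f q else 0)
      = (if q = r then f q else 0)" if q: "q \<in> B" for q r
  proof -
    obtain u es v where q': "q = (u, es, v)" by (cases q)
    have v: "(v, [], v) \<in> A"
      using path_target_in_verts[OF assms(1)] q B by (auto simp: q' A_def)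
    have "(\<Sum>p\<in>A. if path_product p q = Some r then \<one>\<^bsub>path_algebra Q\<^esub> p * f q else 0)
      = (\<Sum>p\<in>A. if p = (v, [], v) then (if q = r then f q else 0) else 0)"
      by (intro sum.cong refl) (auto simp: A_def q' path_algebra_simps split: if_splits)
    also have "\<dots> = (if q = r then f q else 0)"
      using v fin(1) by (subst sum.delta) simp_all
    finally show ?thesis .
  qed
  have right: "(\<Sum>p\<in>A. if path_product q p = Some r then f q * \<one>\<^bsub>path_algebra Q\<^esub> p else 0)
      = (if q = r then f q else 0)" if q: "q \<in> B" for q r
  proof -
    obtain u es v where q': "q = (u, es, v)" by (cases q)
    have u: "(u, [], u) \<in> A"
      using q B by (auto simp: q' A_def mem_paths)
    have "(\<Sum>p\<in>A. if path_product q p = Some r then f q * \<one>\<^bsub>path_algebra Q\<^esub> p else 0)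
      = (\<Sum>p\<in>A. if p = (u, [], u) then (if q = r then f q else 0) else 0)"
      by (intro sum.cong refl) (auto simp: A_def q' path_algebra_simps split: if_splits)
    also have "\<dots> = (if q = r then f q else 0)"
      using u fin(1) by (subst sum.delta) simp_all
    finally show ?thesis .
  qed
  have delta: "(\<Sum>q\<in>B. if q = r then f q else 0) = f r" for r
    using fin(2) by (simp add: B_def)
  show "\<one>\<^bsub>path_algebra Q\<^esub> \<otimes>\<^bsub>path_algebra Q\<^esub> f = f"
  proof
    fix r
    have "(\<one>\<^bsub>path_algebra Q\<^esub> \<otimes>\<^bsub>path_algebra Q\<^esub> f) r = (\<Sum>q\<in>B. \<Sum>p\<in>A.
        if path_product p q = Some r then \<one>\<^bsub>path_algebra Q\<^esub> p * f q else 0)"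
      unfolding path_mult_eq[OF fin sub] by (rule sum.swap)
    also have "\<dots> = (\<Sum>q\<in>B. if q = r then f q else 0)"
      by (intro sum.cong refl left)
    finally show "(\<one>\<^bsub>path_algebra Q\<^esub> \<otimes>\<^bsub>path_algebra Q\<^esub> f) r = f r" using delta by simp
  qed
  show "f \<otimes>\<^bsub>path_algebra Q\<^esub> \<one>\<^bsub>path_algebra Q\<^esub> = f"
  proof
    fix r
    have "(f \<otimes>\<^bsub>path_algebra Q\<^esub> \<one>\<^bsub>path_algebra Q\<^esub>) r = (\<Sum>q\<in>B. if q = r then f q else 0)"
      unfolding path_mult_eq[OF fin(2,1) sub(2,1)] by (intro sum.cong refl right)
    then show "(f \<otimes>\<^bsub>path_algebra Q\<^esub> \<one>\<^bsub>path_algebra Q\<^esub>) r = f r" using delta by simp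
  qed
qed

lemma path_algebra_ring:
  assumes "wf_digraph Q" "finite (verts Q)"
  shows "ring (path_algebra Q)"
proof (rule ringI)
  have add_supp: "{p. f p + g p \<noteq> 0} \<subseteq> {p. f p \<noteq> 0} \<union> {p. g p \<noteq> 0}"
    for f g :: "('a, 'b) path_vector" by auto
  have add_closed: "f \<oplus>\<^bsub>path_algebra Q\<^esub> g \<in> carrier (path_algebra Q)"
    if "f \<in> carrier (path_algebra Q)" "g \<in> carrier (path_algebra Q)" for f g
    using that finite_subset[OF add_supp, of f g] add_supp[of f g]
    unfolding path_algebra_simps by (meson finite_UnI order_trans sup_least)
  show "abelian_group (path_algebra Q)"
  proof (rule abelian_groupI)
    fix f assume "f \<in> carrier (path_algebra Q)"
    then show "\<exists>g\<in>carrier (path_algebra Q). g \<oplus>\<^bsub>path_algebra Q\<^esub> f = \<zero>\<^bsub>path_algebra Q\<^esub>"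
      by (intro bexI[where x = "\<lambda>p. - f p"]) (simp_all add: path_algebra_simps)
  qed (rule add_closed, assumption+, simp_all add: path_algebra_simps add_ac)
  have one_closed: "\<one>\<^bsub>path_algebra Q\<^esub> \<in> carrier (path_algebra Q)"
  proof -
    have "{p. \<one>\<^bsub>path_algebra Q\<^esub> p \<noteq> 0} = (\<lambda>x. (x, [], x)) ` verts Q"
      by (auto simp: path_algebra_simps)
    then show ?thesis
      unfolding path_algebra_simps(1) using assms(2)
      by (auto simp: mem_paths pre_digraph.cas.simps)
  qed
  show "Group.monoid (path_algebra Q)"
    by (rule monoidI) (simp_all add: one_closed path_mult_closed path_mult_assoc path_one_mult[OF assms])
qed (simp_all add: path_algebra_simps path_mult_add)

lemma path_algebra_uminus:
  assumes "wf_digraph Q" "finite (verts Q)" "f \<in> carrier (path_algebra Q)"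
  shows "\<ominus>\<^bsub>path_algebra Q\<^esub> f = (\<lambda>p. - f p)"
proof -
  interpret ring "path_algebra Q" by (rule path_algebra_ring[OF assms(1,2)])
  show ?thesis
    by (rule minus_equality) (use assms(3) in \<open>simp_all add: path_algebra_simps\<close>)
qed

lemma path_algebra_minus:
  assumes "wf_digraph Q" "finite (verts Q)" "g \<in> carrier (path_algebra Q)"
  shows "f \<ominus>\<^bsub>path_algebra Q\<^esub> g = (\<lambda>p. f p - g p)"
  by (simp add: a_minus_def path_algebra_uminus[OF assms] path_algebra_simps)

lemma path_algebra_finsum:
  assumes "wf_digraph Q" "finite (verts Q)" "finite A" "\<And>i. i \<in> A \<Longrightarrow> F i \<in> carrier (path_algebra Q)"
  shows "(\<Oplus>\<^bsub>path_algebra Q\<^esub>i\<in>A. F i) = (\<lambda>p. \<Sum>i\<in>A. F i p)"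
proof -
  interpret ring "path_algebra Q" by (rule path_algebra_ring[OF assms(1,2)])
  show ?thesis
    using assms(3,4)
  proof (induction A)
    case empty
    then show ?case by (simp add: path_algebra_simps)
  next
    case (insert i A)
    then show ?case by (subst add.finprod_insert) (auto simp: path_algebra_simps(3))
  qed
qed

lemma basis_path_closed: "p \<in> paths Q \<Longrightarrow> basis_path p \<in> carrier (path_algebra Q)"
  by (auto simp: path_algebra_simps basis_path_def)

lemma basis_path_mult:
  "basis_path p \<otimes>\<^bsub>path_algebra Q\<^esub> basis_path q =
     (case path_product p q of Some r \<Rightarrow> basis_path r | None \<Rightarrow> (\<lambda>_. 0))"
proof
  fix r
  have "(basis_path p \<otimes>\<^bsub>path_algebra Q\<^esub> basis_path q) r =
      (\<Sum>p'\<in>{p}. \<Sum>q'\<in>{q}. if path_product p' q' = Some r then basis_path p p' * basis_path q q' else 0)"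
    by (rule path_mult_eq) (auto simp: basis_path_def)
  also have "\<dots> = (case path_product p q of Some r \<Rightarrow> basis_path r | None \<Rightarrow> (\<lambda>_. 0)) r"
    by (auto simp: basis_path_def split: option.splits)
  finally show "(basis_path p \<otimes>\<^bsub>path_algebra Q\<^esub> basis_path q) r =
    (case path_product p q of Some r \<Rightarrow> basis_path r | None \<Rightarrow> (\<lambda>_. 0)) r" .
qed

section \<open>Killing arrows\<close>

definition wide_subquiver :: "('x, 'a) pre_digraph \<Rightarrow> ('x, 'a) pre_digraph \<Rightarrow> bool" where
  "wide_subquiver Q' Q \<longleftrightarrow>
     verts Q' = verts Q \<and> arcs Q' \<subseteq> arcs Q \<and> tail Q' = tail Q \<and> head Q' = head Q"

lemma wide_subquiver_cas:
  assumes "wide_subquiver Q' Q"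
  shows "pre_digraph.cas Q' u es v = pre_digraph.cas Q u es v"
  using assms
  by (induction es arbitrary: u) (simp_all add: pre_digraph.cas.simps wide_subquiver_def)

lemma mem_paths_wide_subquiver:
  assumes "wide_subquiver Q' Q"
  shows "(u, es, v) \<in> paths Q' \<longleftrightarrow> (u, es, v) \<in> paths Q \<and> set es \<subseteq> arcs Q'"
  using assms unfolding mem_paths wide_subquiver_cas[OF assms] by (auto simp: wide_subquiver_def)

lemma paths_wide_subquiver:
  assumes "wide_subquiver Q' Q"
  shows "paths Q' \<subseteq> paths Q"
  using mem_paths_wide_subquiver[OF assms] by auto

text \<open>
  A concatenation runs inside the subquiver exactly when both parts do. This is why killing arrows is
  multiplicative.
\<close>

lemma path_product_mem_wide_subquiver:
  assumes Q': "wide_subquiver Q' Q" and pq: "p \<in> paths Q" "q \<in> paths Q"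
    and r: "path_product p q = Some r"
  shows "r \<in> paths Q' \<longleftrightarrow> p \<in> paths Q' \<and> q \<in> paths Q'"
proof -
  obtain u v w es fs where [simp]: "p = (v, es, w)" "q = (u, fs, v)" "r = (u, fs @ es, w)"
    using r unfolding path_product_eq_Some by blast
  show ?thesis
    using pq path_product_in_paths[OF pq r] mem_paths_wide_subquiver[OF Q'] by auto
qed

lemma kill_arrows_closed:
  assumes "f \<in> carrier (path_algebra Q)"
  shows "kill_arrows Q' f \<in> carrier (path_algebra Q')"
proof -
  have "{p. kill_arrows Q' f p \<noteq> 0} \<subseteq> {p. f p \<noteq> 0}" "{p. kill_arrows Q' f p \<noteq> 0} \<subseteq> paths Q'"
    by (auto simp: kill_arrows_def split: if_splits)
  moreover have "finite {p. f p \<noteq> 0}"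
    using assms by (simp add: path_algebra_simps)
  ultimately show ?thesis
    unfolding path_algebra_simps(1) by (simp add: finite_subset[of _ "{p. f p \<noteq> 0}"])
qed

lemma kill_arrows_mult:
  assumes Q': "wide_subquiver Q' Q"
    and f: "f \<in> carrier (path_algebra Q)" and g: "g \<in> carrier (path_algebra Q)"
  shows "kill_arrows Q' (f \<otimes>\<^bsub>path_algebra Q\<^esub> g)
    = kill_arrows Q' f \<otimes>\<^bsub>path_algebra Q'\<^esub> kill_arrows Q' g"
proof
  fix r
  define A B where "A = {p. f p \<noteq> 0}" and "B = {p. g p \<noteq> 0}"
  have fin: "finite A" "finite B" and AB: "A \<subseteq> paths Q" "B \<subseteq> paths Q"
    using f g by (simp_all add: A_def B_def path_algebra_simps)
  have sub: "{p. f p \<noteq> 0} \<subseteq> A" "{p. g p \<noteq> 0} \<subseteq> B"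
    "{p. kill_arrows Q' f p \<noteq> 0} \<subseteq> A" "{p. kill_arrows Q' g p \<noteq> 0} \<subseteq> B"
    by (auto simp: A_def B_def kill_arrows_def split: if_splits)
  have term_eq: "(if r \<in> paths Q' then (if path_product p q = Some r then f p * g q else 0) else 0)
      = (if path_product p q = Some r then kill_arrows Q' f p * kill_arrows Q' g q else 0)"
    if "p \<in> A" "q \<in> B" for p q
  proof (cases "path_product p q = Some r")
    case True
    have "p \<in> paths Q" "q \<in> paths Q" using that AB by auto
    from path_product_mem_wide_subquiver[OF Q' this True] show ?thesis
      by (simp add: kill_arrows_def True)
  qed simp
  have "kill_arrows Q' (f \<otimes>\<^bsub>path_algebra Q\<^esub> g) r = (\<Sum>p\<in>A. \<Sum>q\<in>B.
      if r \<in> paths Q' then (if path_product p q = Some r then f p * g q else 0) else 0)"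
    unfolding kill_arrows_def path_mult_eq[OF fin sub(1,2)] by simp
  also have "\<dots> = (kill_arrows Q' f \<otimes>\<^bsub>path_algebra Q'\<^esub> kill_arrows Q' g) r"
    unfolding path_mult_eq[OF fin sub(3,4)] by (intro sum.cong refl term_eq)
  finally show "kill_arrows Q' (f \<otimes>\<^bsub>path_algebra Q\<^esub> g) r
    = (kill_arrows Q' f \<otimes>\<^bsub>path_algebra Q'\<^esub> kill_arrows Q' g) r" .
qed

lemma trivial_path_mem: "(x, [], x) \<in> paths Q \<longleftrightarrow> x \<in> verts Q"
  by (simp add: mem_paths pre_digraph.cas.simps)

lemma kill_arrows_scalar:
  assumes "wide_subquiver Q' Q"
  shows "kill_arrows Q' (path_algebra_scalar Q c) = path_algebra_scalar Q' c"
proof -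
  have v: "verts Q' = verts Q" using assms by (simp add: wide_subquiver_def)
  show ?thesis
    by (rule ext) (auto simp: kill_arrows_def path_algebra_scalar_def path_algebra_simps
        trivial_path_mem v)
qed

lemma path_algebra_scalar_one: "path_algebra_scalar Q 1 = \<one>\<^bsub>path_algebra Q\<^esub>"
  by (simp add: path_algebra_scalar_def)

lemma kill_arrows_hom:
  assumes Q': "wide_subquiver Q' Q"
  shows "kill_arrows Q' \<in> ring_hom (path_algebra Q) (path_algebra Q')"
proof (rule ring_hom_memI)
  show "kill_arrows Q' \<one>\<^bsub>path_algebra Q\<^esub> = \<one>\<^bsub>path_algebra Q'\<^esub>"
    using kill_arrows_scalar[OF Q', of 1] unfolding path_algebra_scalar_one .
  show "kill_arrows Q' (f \<oplus>\<^bsub>path_algebra Q\<^esub> g)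
    = kill_arrows Q' f \<oplus>\<^bsub>path_algebra Q'\<^esub> kill_arrows Q' g" for f g
    unfolding path_algebra_simps by (rule ext) (simp add: kill_arrows_def)
qed (rule kill_arrows_closed kill_arrows_mult[OF Q'], assumption+)+

lemma inclusion_hom:
  assumes Q': "wide_subquiver Q' Q"
  shows "(\<lambda>f. f) \<in> ring_hom (path_algebra Q') (path_algebra Q)"
proof (rule ring_hom_memI)
  show "\<one>\<^bsub>path_algebra Q'\<^esub> = \<one>\<^bsub>path_algebra Q\<^esub>"
    using Q' by (simp add: path_algebra_simps wide_subquiver_def)
  show "f \<in> carrier (path_algebra Q)" if "f \<in> carrier (path_algebra Q')" for f
    using that paths_wide_subquiver[OF Q'] unfolding path_algebra_simps by blast
qed (simp_all add: path_algebra_def)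

lemma kill_arrows_id:
  assumes "f \<in> carrier (path_algebra Q')"
  shows "kill_arrows Q' f = f"
proof
  fix p
  show "kill_arrows Q' f p = f p"
    using assms by (auto simp: kill_arrows_def path_algebra_simps)
qed

lemma kill_arrows_surj:
  assumes "wide_subquiver Q' Q"
  shows "kill_arrows Q' ` carrier (path_algebra Q) = carrier (path_algebra Q')"
proof
  show "kill_arrows Q' ` carrier (path_algebra Q) \<subseteq> carrier (path_algebra Q')"
    by (rule image_subsetI) (rule kill_arrows_closed)
  show "carrier (path_algebra Q') \<subseteq> kill_arrows Q' ` carrier (path_algebra Q)"
  proof
    fix f assume f: "f \<in> carrier (path_algebra Q')"
    show "f \<in> kill_arrows Q' ` carrier (path_algebra Q)"
      using kill_arrows_id[OF f] ring_hom_closed[OF inclusion_hom[OF assms] f]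
      by (intro image_eqI[where x = f]) simp_all
  qed
qed

lemma kill_arrows_twice:
  assumes "wide_subquiver Q'' Q'"
  shows "kill_arrows Q'' (kill_arrows Q' f) = kill_arrows Q'' f"
  using paths_wide_subquiver[OF assms] by (auto simp: kill_arrows_def fun_eq_iff)

lemma path_algebra_scalar_closed:
  assumes "finite (verts Q)"
  shows "path_algebra_scalar Q c \<in> carrier (path_algebra Q)"
proof -
  let ?T = "(\<lambda>x. (x, [], x)) ` verts Q"
  have 1: "{p. path_algebra_scalar Q c p \<noteq> 0} \<subseteq> ?T"
    by (auto simp: path_algebra_scalar_def path_algebra_simps split: if_splits)
  have 2: "?T \<subseteq> paths Q"
    by (auto simp: trivial_path_mem)
  show ?thesis
    unfolding path_algebra_simps(1)
    using finite_subset[OF 1 finite_imageI[OF assms]] order_trans[OF 1 2] by (rule conjI)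
qed

lemma path_algebra_scalar_mult:
  assumes "wf_digraph Q" "finite (verts Q)" "f \<in> carrier (path_algebra Q)"
  shows "path_algebra_scalar Q c \<otimes>\<^bsub>path_algebra Q\<^esub> f = (\<lambda>p. c * f p)"
proof -
  have one: "\<one>\<^bsub>path_algebra Q\<^esub> \<in> carrier (path_algebra Q)"
    using path_algebra_scalar_closed[OF assms(2), of 1] by (simp add: path_algebra_scalar_one)
  have "path_algebra_scalar Q c \<otimes>\<^bsub>path_algebra Q\<^esub> f
      = (\<lambda>r. c * (\<one>\<^bsub>path_algebra Q\<^esub> \<otimes>\<^bsub>path_algebra Q\<^esub> f) r)"
    unfolding path_algebra_scalar_def
    by (rule path_mult_scale) (use one assms(3) in \<open>simp_all add: path_algebra_simps(1)\<close>)
  then show ?thesis by (simp add: path_one_mult(1)[OF assms])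
qed

text \<open>
  The elements \<^term>\<open>path_algebra_scalar Q c\<close> belong to the algebra, so a two-sided ideal is closed
  under multiplication by complex numbers.
\<close>

lemma mem_ideal_of_basis_paths:
  assumes Q: "wf_digraph Q" "finite (verts Q)" and I: "ideal I (path_algebra Q)"
    and "finite P" and "\<And>p. p \<in> P \<Longrightarrow> basis_path p \<in> I" and "\<And>p. p \<notin> P \<Longrightarrow> f p = 0"
  shows "f \<in> I"
proof -
  interpret ideal I "path_algebra Q" by (rule I)
  show ?thesis
    using assms(4-6)
  proof (induction P arbitrary: f)
    case empty
    then have "f = \<zero>\<^bsub>path_algebra Q\<^esub>"
      unfolding path_algebra_simps by (intro ext) simp
    then show ?case using zero_closed by simp
  next
    case (insert p P)
    have b: "basis_path p \<in> I" using insert.prems(1) by simp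
    have 1: "f(p := 0) \<in> I"
      by (rule insert.IH) (use insert.prems in auto)
    have "path_algebra_scalar Q (f p) \<otimes>\<^bsub>path_algebra Q\<^esub> basis_path p \<in> I"
      by (rule I_l_closed[OF b path_algebra_scalar_closed[OF Q(2)]])
    then have 2: "(\<lambda>q. f p * basis_path p q) \<in> I"
      unfolding path_algebra_scalar_mult[OF Q Icarr[OF b]] .
    have "(\<lambda>q. f p * basis_path p q) \<oplus>\<^bsub>path_algebra Q\<^esub> f(p := 0) \<in> I"
      by (rule additive_subgroup.a_closed[OF is_additive_subgroup 2 1])
    moreover have "(\<lambda>q. f p * basis_path p q) \<oplus>\<^bsub>path_algebra Q\<^esub> f(p := 0) = f"
      unfolding path_algebra_simps by (rule ext) (simp add: basis_path_def)
    ultimately show ?case by simp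
  qed
qed

text \<open>
  The path factors as (rest after \<open>a\<close>) times \<open>a\<close> times (part before \<open>a\<close>).
\<close>

lemma basis_path_mem_ideal:
  assumes Q: "wf_digraph Q" and I: "ideal I (path_algebra Q)"
    and p: "(u, es @ a # fs, v) \<in> paths Q" and a: "basis_path (tail Q a, [a], head Q a) \<in> I"
  shows "basis_path (u, es @ a # fs, v) \<in> I"
proof -
  interpret ideal I "path_algebra Q" by (rule I)
  have arc: "a \<in> arcs Q" and cas: "pre_digraph.cas Q u es (tail Q a)"
    "pre_digraph.cas Q (head Q a) fs v"
    using p by (auto simp: mem_paths cas_append pre_digraph.cas.simps)
  have paths: "(u, es, tail Q a) \<in> paths Q" "(head Q a, fs, v) \<in> paths Q"
    using p cas wf_digraph.head_in_verts[OF Q arc] by (simp_all add: mem_paths)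
  have "basis_path (head Q a, fs, v) \<otimes>\<^bsub>path_algebra Q\<^esub>
      (basis_path (tail Q a, [a], head Q a) \<otimes>\<^bsub>path_algebra Q\<^esub> basis_path (u, es, tail Q a)) \<in> I"
    by (rule I_l_closed[OF I_r_closed[OF a basis_path_closed[OF paths(1)]]
          basis_path_closed[OF paths(2)]])
  then show ?thesis by (simp add: basis_path_mult)
qed

text \<open>
  The difference is a combination of paths through at least one killed arrow. So the kernel of
  \<^term>\<open>kill_arrows Q'\<close> lies in any ideal that contains the killed arrows.
\<close>

lemma diff_kill_arrows_mem_ideal:
  assumes Q: "wf_digraph Q" "finite (verts Q)" and Q': "wide_subquiver Q' Q"
    and I: "ideal I (path_algebra Q)"
    and arcs: "\<And>a. a \<in> arcs Q - arcs Q' \<Longrightarrow> basis_path (tail Q a, [a], head Q a) \<in> I"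
    and f: "f \<in> carrier (path_algebra Q)"
  shows "f \<ominus>\<^bsub>path_algebra Q\<^esub> kill_arrows Q' f \<in> I"
proof -
  have k: "kill_arrows Q' f \<in> carrier (path_algebra Q)"
    using ring_hom_closed[OF inclusion_hom[OF Q'] kill_arrows_closed[OF f]] .
  show ?thesis
    unfolding path_algebra_minus[OF Q k]
  proof (rule mem_ideal_of_basis_paths[OF Q I])
    show "finite ({p. f p \<noteq> 0} - paths Q')" using f by (simp add: path_algebra_simps)
    show "f p - kill_arrows Q' f p = 0" if "p \<notin> {p. f p \<noteq> 0} - paths Q'" for p
      using that by (auto simp: kill_arrows_def)
    fix p assume p: "p \<in> {p. f p \<noteq> 0} - paths Q'"
    obtain u es v where p': "p = (u, es, v)" by (cases p)
    have path: "(u, es, v) \<in> paths Q" "(u, es, v) \<notin> paths Q'"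
      using p f by (auto simp: path_algebra_simps p')
    then obtain a where a: "a \<in> set es" "a \<notin> arcs Q'"
      using mem_paths_wide_subquiver[OF Q'] by auto
    then obtain fs gs where es: "es = fs @ a # gs" by (meson split_list)
    have "a \<in> arcs Q" using path(1) a(1) by (auto simp: mem_paths)
    then show "basis_path p \<in> I"
      unfolding p' es using a(2) path(1) arcs[of a]
      by (intro basis_path_mem_ideal[OF Q(1) I, of u fs a gs v]) (simp_all add: es)
  qed
qed

section \<open>The algebras \<open>W\<^sub>j(Q)\<close> and the maps between them\<close>

lemma with_loops_simps:
  "verts (with_loops Q J) = verts Q"
  "arcs (with_loops Q J) = Arrow ` arcs Q \<union> {Loop i x | i x. i \<in> J \<and> x \<in> verts Q}"
  "tail (with_loops Q J) (Loop i x) = x" "head (with_loops Q J) (Loop i x) = x"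
  by (simp_all add: with_loops_def)

lemma with_loops_wf:
  assumes "wf_digraph Q"
  shows "wf_digraph (with_loops Q J)"
  using assms unfolding wf_digraph_def by (auto simp: with_loops_def)

lemma with_loops_wide_subquiver:
  assumes "J \<subseteq> K"
  shows "wide_subquiver (with_loops Q J) (with_loops Q K)"
  using assms by (auto simp: wide_subquiver_def with_loops_def)

lemma loop_path_mem:
  "(x, [Loop i x], x) \<in> paths (with_loops Q J) \<longleftrightarrow> x \<in> verts Q \<and> i \<in> J"
  by (auto simp: mem_paths pre_digraph.cas.simps with_loops_simps)

lemma loops_path_mem:
  "(x, [Loop k x, Loop i x], x) \<in> paths (with_loops Q J) \<longleftrightarrow> x \<in> verts Q \<and> i \<in> J \<and> k \<in> J"
  by (auto simp: mem_paths pre_digraph.cas.simps with_loops_simps)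

lemma vertex_path_mem: "(x, [], x) \<in> paths (with_loops Q J) \<longleftrightarrow> x \<in> verts Q"
  by (simp add: trivial_path_mem with_loops_simps)

lemma loop_elem_closed:
  "\<lbrakk>x \<in> verts Q; i \<in> J\<rbrakk> \<Longrightarrow> loop_elem i x \<in> carrier (path_algebra (with_loops Q J))"
  by (simp add: loop_elem_def basis_path_closed loop_path_mem)

lemma vertex_elem_closed:
  "x \<in> verts Q \<Longrightarrow> vertex_elem x \<in> carrier (path_algebra (with_loops Q J))"
  by (simp add: vertex_elem_def basis_path_closed vertex_path_mem)

lemma loop_vertex_mult:
  "loop_elem i x \<otimes>\<^bsub>path_algebra Q\<^esub> loop_elem k x = basis_path (x, [Loop k x, Loop i x], x)"
  "loop_elem i x \<otimes>\<^bsub>path_algebra Q\<^esub> vertex_elem x = loop_elem i x"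
  "vertex_elem x \<otimes>\<^bsub>path_algebra Q\<^esub> loop_elem i x = loop_elem i x"
  "vertex_elem x \<otimes>\<^bsub>path_algebra Q\<^esub> vertex_elem x = vertex_elem x"
  by (simp_all add: loop_elem_def vertex_elem_def basis_path_mult)

lemma kill_arrows_basis_path:
  "kill_arrows Q' (basis_path p) = (if p \<in> paths Q' then basis_path p else (\<lambda>_. 0))"
  by (auto simp: kill_arrows_def basis_path_def fun_eq_iff)

abbreviation level :: "nat \<Rightarrow> int set" where
  "level j \<equiv> {- int j..int j}"

text \<open>
  The generators of \<^term>\<open>I_ideal Q j\<close>; naming them allows the arguments below to treat the two kinds
  of generators by cases.
\<close>

definition relations :: "('x, 'e) pre_digraph \<Rightarrow> nat \<Rightarrow> ('x, 'e) loop_vector set" where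
  "relations Q j =
     {loop_elem i x \<otimes>\<^bsub>CQ Q j\<^esub> loop_elem k x | i k x.
        x \<in> verts Q \<and> i \<in> level j \<and> k \<in> level j \<and> i \<noteq> k} \<union>
     {(\<Oplus>\<^bsub>CQ Q j\<^esub>i\<in>level j. loop_elem i x) \<ominus>\<^bsub>CQ Q j\<^esub> vertex_elem x | x. x \<in> verts Q}"

lemma I_ideal_eq: "I_ideal Q j = Idl\<^bsub>CQ Q j\<^esub> (relations Q j)"
  by (simp add: I_ideal_def relations_def)

definition W_proj ::
  "('x, 'e) pre_digraph \<Rightarrow> nat \<Rightarrow> ('x, 'e) loop_vector \<Rightarrow> ('x, 'e) loop_vector set" where
  "W_proj Q j f = W_class Q j (kill_arrows (with_loops Q (level j)) f)"

lemma to_Idem_eq: "to_Idem Q j = restriction_functor (CQ_hat Q) (W_proj Q j)"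
  unfolding to_Idem_def W_proj_def ..

locale finite_quiver =
  fixes Q :: "('x, 'e) pre_digraph"
  assumes wf: "wf_digraph Q" and finite_verts: "finite (verts Q)"
begin

lemma loops_wf: "wf_digraph (with_loops Q J)" "finite (verts (with_loops Q J))"
  using with_loops_wf[OF wf] finite_verts by (simp_all add: with_loops_simps)

lemma loops_ring: "ring (path_algebra (with_loops Q J))"
  by (rule path_algebra_ring[OF loops_wf])

lemma CQ_ring: "ring (CQ Q j)" and CQ_hat_ring: "ring (CQ_hat Q)"
  unfolding CQ_def CQ_hat_def by (rule loops_ring)+

text \<open>
  The left-hand side refers to a particular path algebra, the right-hand side does not. This lets the
  same relation be used in the path algebras of all the quivers with loops.
\<close>

lemma sum_relation_eq:
  assumes "x \<in> verts Q" "finite L" "L \<subseteq> J"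
  shows "(\<Oplus>\<^bsub>path_algebra (with_loops Q J)\<^esub>i\<in>L. loop_elem i x)
      \<ominus>\<^bsub>path_algebra (with_loops Q J)\<^esub> vertex_elem x
    = (\<lambda>p. (\<Sum>i\<in>L. loop_elem i x p) - vertex_elem x p)"
proof -
  have l: "loop_elem i x \<in> carrier (path_algebra (with_loops Q J))" if "i \<in> L" for i
    using that assms by (intro loop_elem_closed) auto
  have "(\<Oplus>\<^bsub>path_algebra (with_loops Q J)\<^esub>i\<in>L. loop_elem i x) = (\<lambda>p. \<Sum>i\<in>L. loop_elem i x p)"
    by (rule path_algebra_finsum[OF loops_wf assms(2)]) (rule l)
  then show ?thesis
    by (simp add: path_algebra_minus[OF loops_wf vertex_elem_closed[OF assms(1)]])
qed

lemma relation_cases: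
  assumes "r \<in> relations Q j"
  obtains (orthogonal) i k x where "x \<in> verts Q" "i \<in> level j" "k \<in> level j" "i \<noteq> k"
      "r = basis_path (x, [Loop k x, Loop i x], x)"
    | (decomposition) x where "x \<in> verts Q"
      "r = (\<lambda>p. (\<Sum>i\<in>level j. loop_elem i x p) - vertex_elem x p)"
proof -
  from assms consider
    i k x where "x \<in> verts Q" "i \<in> level j" "k \<in> level j" "i \<noteq> k"
      "r = basis_path (x, [Loop k x, Loop i x], x)"
    | x where "x \<in> verts Q"
      "r = (\<Oplus>\<^bsub>CQ Q j\<^esub>i\<in>level j. loop_elem i x) \<ominus>\<^bsub>CQ Q j\<^esub> vertex_elem x"
    unfolding relations_def CQ_def loop_vertex_mult(1) by blast
  then show thesis
  proof cases
    case 1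
    then show thesis by (rule orthogonal)
  next
    case 2
    then show thesis
      using sum_relation_eq[OF 2(1) finite_atLeastAtMost_int order_refl]
      by (intro decomposition[OF 2(1)]) (simp add: CQ_def)
  qed
qed

lemma relationsI:
  "\<lbrakk>x \<in> verts Q; i \<in> level j; k \<in> level j; i \<noteq> k\<rbrakk> \<Longrightarrow>
    basis_path (x, [Loop k x, Loop i x], x) \<in> relations Q j"
  "x \<in> verts Q \<Longrightarrow> (\<lambda>p. (\<Sum>i\<in>level j. loop_elem i x p) - vertex_elem x p) \<in> relations Q j"
proof -
  show "basis_path (x, [Loop k x, Loop i x], x) \<in> relations Q j"
    if "x \<in> verts Q" "i \<in> level j" "k \<in> level j" "i \<noteq> k"
    unfolding relations_def CQ_def loop_vertex_mult(1) using that by blast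
  show "(\<lambda>p. (\<Sum>i\<in>level j. loop_elem i x p) - vertex_elem x p) \<in> relations Q j"
    if "x \<in> verts Q"
    unfolding relations_def CQ_def sum_relation_eq[OF that finite_atLeastAtMost_int order_refl, symmetric]
    using that by blast
qed

lemma relations_closed: "relations Q j \<subseteq> carrier (CQ Q j)"
proof
  fix r assume "r \<in> relations Q j"
  then show "r \<in> carrier (CQ Q j)"
  proof (cases rule: relation_cases)
    case (orthogonal i k x)
    then show ?thesis by (simp add: CQ_def basis_path_closed loops_path_mem)
  next
    case (decomposition x)
    interpret ring "CQ Q j" by (rule CQ_ring)
    have "(\<Oplus>\<^bsub>CQ Q j\<^esub>i\<in>level j. loop_elem i x) \<ominus>\<^bsub>CQ Q j\<^esub> vertex_elem x \<in> carrier (CQ Q j)"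
      using decomposition(1)
      by (intro minus_closed add.finprod_closed)
        (auto simp: CQ_def loop_elem_closed vertex_elem_closed)
    then show ?thesis
      unfolding decomposition(2) CQ_def
        sum_relation_eq[OF decomposition(1) finite_atLeastAtMost_int order_refl] .
  qed
qed

lemma I_ideal_ideal: "ideal (I_ideal Q j) (CQ Q j)"
  unfolding I_ideal_eq by (rule ring.genideal_ideal[OF CQ_ring relations_closed])

lemma relations_subset_I_ideal: "relations Q j \<subseteq> I_ideal Q j"
  unfolding I_ideal_eq by (rule ring.genideal_self[OF CQ_ring relations_closed])

lemma I_ideal_subset:
  assumes "ideal I (CQ Q j)" "relations Q j \<subseteq> I"
  shows "I_ideal Q j \<subseteq> I"
  unfolding I_ideal_eq by (rule ring.genideal_minimal[OF CQ_ring assms])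

lemma W_ring: "ring (W Q j)"
  unfolding W_def by (rule ideal.quotient_is_ring[OF I_ideal_ideal])

lemma W_class_hom: "W_class Q j \<in> ring_hom (CQ Q j) (W Q j)"
proof -
  have "W_class Q j = (+>\<^bsub>CQ Q j\<^esub>) (I_ideal Q j)" by (rule ext) (simp add: W_class_def)
  then show ?thesis
    unfolding W_def using ideal.rcos_ring_hom[OF I_ideal_ideal] by simp
qed

lemma W_class_surj: "W_class Q j ` carrier (CQ Q j) = carrier (W Q j)"
  by (auto simp: W_def W_class_def FactRing_def A_RCOSETS_defs a_r_coset_def)

lemma W_class_eq_zero_iff:
  assumes "f \<in> carrier (CQ Q j)"
  shows "W_class Q j f = \<zero>\<^bsub>W Q j\<^esub> \<longleftrightarrow> f \<in> I_ideal Q j"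
proof -
  have z: "\<zero>\<^bsub>W Q j\<^esub> = I_ideal Q j" by (simp add: W_def FactRing_def)
  show ?thesis
    unfolding z W_class_def
    using ideal.rcos_const_imp_mem[OF I_ideal_ideal assms]
      ring.a_rcos_zero[OF CQ_ring I_ideal_ideal] by blast
qed

lemma kill_hom_CQ_hat: "kill_arrows (with_loops Q (level j)) \<in> ring_hom (CQ_hat Q) (CQ Q j)"
  unfolding CQ_hat_def CQ_def by (intro kill_arrows_hom with_loops_wide_subquiver) simp

lemma kill_hom_CQ: "kill_arrows (with_loops Q (level j)) \<in> ring_hom (CQ Q (Suc j)) (CQ Q j)"
  unfolding CQ_def by (intro kill_arrows_hom with_loops_wide_subquiver) auto

lemma W_proj_hom: "W_proj Q j \<in> ring_hom (CQ_hat Q) (W Q j)"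
proof -
  have "W_proj Q j = W_class Q j \<circ> kill_arrows (with_loops Q (level j))"
    by (rule ext) (simp add: W_proj_def)
  then show ?thesis
    using ring_hom_trans[OF kill_hom_CQ_hat W_class_hom] by simp
qed

lemma W_proj_surj: "W_proj Q j ` carrier (CQ_hat Q) = carrier (W Q j)"
proof -
  have "kill_arrows (with_loops Q (level j)) ` carrier (CQ_hat Q) = carrier (CQ Q j)"
    unfolding CQ_hat_def CQ_def by (intro kill_arrows_surj with_loops_wide_subquiver) simp
  then show ?thesis
    unfolding W_proj_def image_comp[symmetric, unfolded comp_def] W_class_surj[symmetric]
    by (simp add: image_image[symmetric])
qed

lemma scalar_hat_closed: "path_algebra_scalar (with_loops Q UNIV) c \<in> carrier (CQ_hat Q)"
  unfolding CQ_hat_def by (rule path_algebra_scalar_closed[OF loops_wf(2)])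

lemma W_proj_scalar: "W_proj Q j (path_algebra_scalar (with_loops Q UNIV) c) = W_scalar Q j c"
  unfolding W_proj_def W_scalar_def
  by (subst kill_arrows_scalar[OF with_loops_wide_subquiver]) simp_all

sublocale hat: scalar_restriction "CQ_hat Q" "W Q j" "W_proj Q j"
    "path_algebra_scalar (with_loops Q UNIV)" "W_scalar Q j" for j
  by (intro scalar_restriction.intro CQ_hat_ring W_ring W_proj_hom W_proj_surj scalar_hat_closed
      W_proj_scalar)

text \<open>
  It suffices to look at generators. An orthogonality relation that involves one of the loops
  with index \<open>j + 1\<close> or \<open>-(j + 1)\<close> is killed, any other one is kept, and the decomposition of the
  identity loses the terms with these two indices.
\<close>

lemma kill_I_ideal:
  assumes "f \<in> I_ideal Q (Suc j)"
  shows "kill_arrows (with_loops Q (level j)) f \<in> I_ideal Q j"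
proof -
  interpret ring_hom_ring "CQ Q (Suc j)" "CQ Q j" "kill_arrows (with_loops Q (level j))"
    by (rule ring_hom_ringI2[OF CQ_ring CQ_ring kill_hom_CQ])
  have "relations Q (Suc j)
      \<subseteq> {r \<in> carrier (CQ Q (Suc j)). kill_arrows (with_loops Q (level j)) r \<in> I_ideal Q j}"
  proof
    fix r assume r: "r \<in> relations Q (Suc j)"
    have "kill_arrows (with_loops Q (level j)) r \<in> I_ideal Q j"
      using r
    proof (cases rule: relation_cases)
      case (orthogonal i k x)
      show ?thesis
      proof (cases "i \<in> level j \<and> k \<in> level j")
        case True
        then have "kill_arrows (with_loops Q (level j)) r = r"
          unfolding orthogonal(5) using orthogonal(1)
          by (simp add: kill_arrows_basis_path loops_path_mem)
        moreover have "r \<in> relations Q j"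
          unfolding orthogonal(5) using orthogonal True by (intro relationsI) auto
        ultimately show ?thesis using relations_subset_I_ideal by auto
      next
        case False
        then have "(x, [Loop k x, Loop i x], x) \<notin> paths (with_loops Q (level j))"
          unfolding loops_path_mem by blast
        then have "kill_arrows (with_loops Q (level j)) r = \<zero>\<^bsub>CQ Q j\<^esub>"
          unfolding orthogonal(5) kill_arrows_basis_path by (simp add: CQ_def path_algebra_simps)
        then show ?thesis
          using additive_subgroup.zero_closed[OF ideal.axioms(1)[OF I_ideal_ideal]] by simp
      qed
    next
      case (decomposition x)
      have "kill_arrows (with_loops Q (level j)) r
        = (\<lambda>p. (\<Sum>i\<in>level j. loop_elem i x p) - vertex_elem x p)"
      proof
        fix p
        show "kill_arrows (with_loops Q (level j)) r p
          = (\<Sum>i\<in>level j. loop_elem i x p) - vertex_elem x p"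
        proof (cases "p \<in> paths (with_loops Q (level j))")
          case True
          \<comment> \<open>No loop outside the smaller range is a path of the smaller quiver.\<close>
          have "(\<Sum>i\<in>level (Suc j). loop_elem i x p) = (\<Sum>i\<in>level j. loop_elem i x p)"
          proof (rule sum.mono_neutral_right)
            show "\<forall>i\<in>level (Suc j) - level j. loop_elem i x p = 0"
              using True loop_path_mem[of x _ Q "level j"]
              by (auto simp: loop_elem_def basis_path_def)
          qed auto
          then show ?thesis
            unfolding decomposition(2) kill_arrows_def using True by simp
        next
          case False
          have "vertex_elem x p = 0"
            using False vertex_path_mem[of x Q "level j"] decomposition(1)
            by (auto simp: vertex_elem_def basis_path_def)
          moreover have "loop_elem i x p = 0" if "i \<in> level j" for i
            using False loop_path_mem[of x i Q "level j"] decomposition(1) that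
            by (auto simp: loop_elem_def basis_path_def)
          ultimately show ?thesis
            unfolding kill_arrows_def using False by simp
        qed
      qed
      then show ?thesis
        using relationsI(2)[OF decomposition(1)] relations_subset_I_ideal by auto
    qed
    then show "r \<in> {r \<in> carrier (CQ Q (Suc j)).
        kill_arrows (with_loops Q (level j)) r \<in> I_ideal Q j}"
      using r relations_closed by blast
  qed
  then have "I_ideal Q (Suc j)
      \<subseteq> {r \<in> carrier (CQ Q (Suc j)). kill_arrows (with_loops Q (level j)) r \<in> I_ideal Q j}"
    by (rule I_ideal_subset[OF ideal_vimage[OF I_ideal_ideal]])
  then show ?thesis using assms by blast
qed

text \<open>
  By definition \<^const>\<open>W_surj\<close> takes the unique element of the image of a coset; it is unique because
  the ideal by which one divides is mapped into the ideal of the next smaller level.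
\<close>

lemma W_surj_class:
  assumes g: "g \<in> carrier (CQ Q (Suc j))"
  shows "W_surj Q j (W_class Q (Suc j) g) = W_class Q j (kill_arrows (with_loops Q (level j)) g)"
proof -
  let ?k = "kill_arrows (with_loops Q (level j))"
  interpret I: ideal "I_ideal Q (Suc j)" "CQ Q (Suc j)" by (rule I_ideal_ideal)
  interpret W: ring "W Q j" by (rule W_ring)
  have const: "W_class Q j (?k (a \<oplus>\<^bsub>CQ Q (Suc j)\<^esub> g)) = W_class Q j (?k g)"
    if a: "a \<in> I_ideal Q (Suc j)" for a
  proof -
    have ka: "?k a \<in> carrier (CQ Q j)" and kg: "?k g \<in> carrier (CQ Q j)"
      using ring_hom_closed[OF kill_hom_CQ] I.Icarr[OF a] g by simp_all
    have const: "W_class Q j (?k (a \<oplus>\<^bsub>CQ Q (Suc j)\<^esub> g))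
        = W_class Q j (?k a) \<oplus>\<^bsub>W Q j\<^esub> W_class Q j (?k g)"
      using ring_hom_add[OF kill_hom_CQ I.Icarr[OF a] g] ring_hom_add[OF W_class_hom ka kg] by simp
    also have "W_class Q j (?k a) = \<zero>\<^bsub>W Q j\<^esub>"
      using kill_I_ideal[OF a] W_class_eq_zero_iff[OF ka] by simp
    finally show ?thesis
      using ring_hom_closed[OF W_class_hom kg] by simp
  qed
  have "W_class Q (Suc j) g = (\<lambda>a. a \<oplus>\<^bsub>CQ Q (Suc j)\<^esub> g) ` I_ideal Q (Suc j)"
    unfolding W_class_def a_r_coset_def' by blast
  then have "(\<lambda>f. W_class Q j (?k f)) ` W_class Q (Suc j) g
      = (\<lambda>a. W_class Q j (?k g)) ` I_ideal Q (Suc j)"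
    using const by (simp add: image_image)
  also have "\<dots> = {W_class Q j (?k g)}"
    using additive_subgroup.zero_closed[OF I.is_additive_subgroup] by blast
  finally have "(\<lambda>f. W_class Q j (?k f)) ` W_class Q (Suc j) g = {W_class Q j (?k g)}" .
  then show ?thesis by (simp add: W_surj_def)
qed

lemma W_surj_proj:
  assumes "f \<in> carrier (CQ_hat Q)"
  shows "W_surj Q j (W_proj Q (Suc j) f) = W_proj Q j f"
  unfolding W_proj_def W_surj_class[OF ring_hom_closed[OF kill_hom_CQ_hat assms]]
  by (subst kill_arrows_twice[OF with_loops_wide_subquiver]) auto

sublocale step: scalar_restriction "W Q (Suc j)" "W Q j" "W_surj Q j" "W_scalar Q (Suc j)"
    "W_scalar Q j" for j
proof (rule scalar_restriction.intro)
  show "ring (W Q (Suc j))" "ring (W Q j)" by (rule W_ring)+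
  show "W_surj Q j \<in> ring_hom (W Q (Suc j)) (W Q j)"
    by (rule ring_hom_factor[OF W_proj_hom W_proj_surj W_proj_hom W_surj_proj CQ_hat_ring])
  show "W_surj Q j ` carrier (W Q (Suc j)) = carrier (W Q j)"
    unfolding W_proj_surj[symmetric] image_image using W_surj_proj by (intro image_cong refl)
  show "W_scalar Q (Suc j) c \<in> carrier (W Q (Suc j))" for c
    unfolding W_proj_scalar[symmetric] by (rule ring_hom_closed[OF W_proj_hom scalar_hat_closed])
  show "W_surj Q j (W_scalar Q (Suc j) c) = W_scalar Q j c" for c
    unfolding W_proj_scalar[symmetric] by (rule W_surj_proj[OF scalar_hat_closed])
qed

end

section \<open>Modules that decompose into idempotents\<close>

locale finite_quiver_module = finite_quiver Q + left_module "CQ_hat Q" N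
  for Q :: "('x, 'e) pre_digraph" and N :: "(('x, 'e) loop_vector, 'v) module"
begin

lemma elem_closed:
  "x \<in> verts Q \<Longrightarrow> loop_elem i x \<in> carrier (CQ_hat Q)"
  "x \<in> verts Q \<Longrightarrow> vertex_elem x \<in> carrier (CQ_hat Q)"
  by (simp_all add: CQ_hat_def loop_elem_closed vertex_elem_closed)

lemma loop_closed: "\<lbrakk>x \<in> verts Q; m \<in> carrier N\<rbrakk> \<Longrightarrow> loop_elem i x \<odot>\<^bsub>N\<^esub> m \<in> carrier N"
  by (intro smult_closed elem_closed)

lemma vertex_space_subset: "x \<in> verts Q \<Longrightarrow> vertex_space N x \<subseteq> carrier N"
  by (auto simp: vertex_space_def intro: smult_closed elem_closed)

lemma vertex_smult_mem: "m \<in> carrier N \<Longrightarrow> vertex_elem x \<odot>\<^bsub>N\<^esub> m \<in> vertex_space N x"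
  by (auto simp: vertex_space_def)

lemma loop_smult_vertex:
  assumes "x \<in> verts Q" "m \<in> carrier N"
  shows "loop_elem i x \<odot>\<^bsub>N\<^esub> (vertex_elem x \<odot>\<^bsub>N\<^esub> m) = loop_elem i x \<odot>\<^bsub>N\<^esub> m"
    and "vertex_elem x \<odot>\<^bsub>N\<^esub> (loop_elem i x \<odot>\<^bsub>N\<^esub> m) = loop_elem i x \<odot>\<^bsub>N\<^esub> m"
    and "vertex_elem x \<odot>\<^bsub>N\<^esub> (vertex_elem x \<odot>\<^bsub>N\<^esub> m) = vertex_elem x \<odot>\<^bsub>N\<^esub> m"
  using smult_assoc[OF elem_closed(1)[OF assms(1), of i] elem_closed(2)[OF assms(1)] assms(2)]
    smult_assoc[OF elem_closed(2)[OF assms(1)] elem_closed(1)[OF assms(1), of i] assms(2)]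
    smult_assoc[OF elem_closed(2)[OF assms(1)] elem_closed(2)[OF assms(1)] assms(2)]
  by (simp_all add: CQ_hat_def loop_vertex_mult)

lemma vertex_smult_vertex_space:
  assumes "x \<in> verts Q" "m \<in> vertex_space N x"
  shows "vertex_elem x \<odot>\<^bsub>N\<^esub> m = m"
  using assms loop_smult_vertex(3)[OF assms(1)] by (auto simp: vertex_space_def)

lemma loop_annihilates:
  assumes "x \<in> verts Q" "m \<in> carrier N" "i \<notin> nonzero_loops N x"
  shows "loop_elem i x \<odot>\<^bsub>N\<^esub> m = \<zero>\<^bsub>N\<^esub>"
proof -
  have "loop_elem i x \<odot>\<^bsub>N\<^esub> (vertex_elem x \<odot>\<^bsub>N\<^esub> m) = \<zero>\<^bsub>N\<^esub>"
    using assms(3) vertex_smult_mem[OF assms(2)] unfolding nonzero_loops_def by blast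
  then show ?thesis using loop_smult_vertex(1)[OF assms(1,2)] by simp
qed

lemma sum_relation_smult_eq_zero_iff:
  assumes x: "x \<in> verts Q" and m: "m \<in> carrier N"
  shows "(\<lambda>p. (\<Sum>i\<in>level j. loop_elem i x p) - vertex_elem x p) \<odot>\<^bsub>N\<^esub> m = \<zero>\<^bsub>N\<^esub> \<longleftrightarrow>
    (\<Oplus>\<^bsub>N\<^esub>i\<in>level j. loop_elem i x \<odot>\<^bsub>N\<^esub> m) = vertex_elem x \<odot>\<^bsub>N\<^esub> m"
proof -
  have sum: "(\<Oplus>\<^bsub>CQ_hat Q\<^esub>i\<in>level j. loop_elem i x) \<in> carrier (CQ_hat Q)"
    by (rule R.add.finprod_closed) (use elem_closed(1)[OF x] in auto)
  have eq: "(\<lambda>p. (\<Sum>i\<in>level j. loop_elem i x p) - vertex_elem x p)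
    = (\<Oplus>\<^bsub>CQ_hat Q\<^esub>i\<in>level j. loop_elem i x) \<ominus>\<^bsub>CQ_hat Q\<^esub> vertex_elem x"
    unfolding CQ_hat_def
    by (rule sum_relation_eq[OF x, symmetric]) simp_all
  have "(\<Oplus>\<^bsub>CQ_hat Q\<^esub>i\<in>level j. loop_elem i x) \<odot>\<^bsub>N\<^esub> m
    = (\<Oplus>\<^bsub>N\<^esub>i\<in>level j. loop_elem i x \<odot>\<^bsub>N\<^esub> m)"
    by (rule finsum_smult[OF _ elem_closed(1)[OF x] m]) simp
  then show ?thesis
    unfolding eq using minus_smult_eq_zero_iff[OF sum elem_closed(2)[OF x] m] by simp
qed

lemma orthogonality_smult:
  assumes x: "x \<in> verts Q" and m: "m \<in> carrier N"
  shows "basis_path (x, [Loop k x, Loop i x], x) \<odot>\<^bsub>N\<^esub> m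
    = loop_elem i x \<odot>\<^bsub>N\<^esub> (loop_elem k x \<odot>\<^bsub>N\<^esub> m)"
  using smult_assoc[OF elem_closed(1)[OF x, of i] elem_closed(1)[OF x, of k] m]
  by (simp add: CQ_hat_def loop_vertex_mult)

lemma annihilator_iff:
  "f \<in> annihilator \<longleftrightarrow> f \<in> carrier (CQ_hat Q) \<and> (\<forall>m\<in>carrier N. f \<odot>\<^bsub>N\<^esub> m = \<zero>\<^bsub>N\<^esub>)"
  by (auto simp: annihilator_def)

lemma inclusion_CQ: "(\<lambda>f. f) \<in> ring_hom (CQ Q j) (CQ_hat Q)"
  unfolding CQ_def CQ_hat_def by (intro inclusion_hom with_loops_wide_subquiver) simp

text \<open>
  Up to an element of the ideal generated by the loops outside the range \<open>-j..j\<close>, the element \<open>f\<close> is an element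
  of \<^term>\<open>I_ideal Q j\<close>. Both ideals annihilate \<open>N\<close>, as their generators do: a loop that is not among
  the nonzero loops acts as zero, and the relations hold by the assumption on the nonzero loops.
\<close>

lemma kernel_annihilates:
  assumes idem: "idem_decomposition Q N"
    and loops: "\<And>x. x \<in> verts Q \<Longrightarrow> nonzero_loops N x \<subseteq> level j"
    and f: "f \<in> carrier (CQ_hat Q)" and ker: "W_proj Q j f = \<zero>\<^bsub>W Q j\<^esub>"
  shows "f \<in> annihilator"
proof -
  let ?k = "kill_arrows (with_loops Q (level j))"
  have D: "loop_elem i x \<odot>\<^bsub>N\<^esub> (loop_elem k x \<odot>\<^bsub>N\<^esub> m) = \<zero>\<^bsub>N\<^esub>"
    if "x \<in> verts Q" "i \<in> nonzero_loops N x" "k \<in> nonzero_loops N x" "i \<noteq> k"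
      "m \<in> vertex_space N x" for x i k m
    using idem that unfolding idem_decomposition_def by blast
  have S: "(\<Oplus>\<^bsub>N\<^esub>i\<in>nonzero_loops N x. loop_elem i x \<odot>\<^bsub>N\<^esub> m) = m"
    if "x \<in> verts Q" "m \<in> vertex_space N x" for x m
    using idem that unfolding idem_decomposition_def by blast
  have outer: "loop_elem i x \<in> annihilator" if "x \<in> verts Q" "i \<notin> level j" for i x
    using that loops[OF that(1)] loop_annihilates[OF that(1)] elem_closed(1)[OF that(1)]
    unfolding annihilator_iff by blast
  have rel: "relations Q j \<subseteq> annihilator"
  proof
    fix r assume r: "r \<in> relations Q j"
    have "r \<odot>\<^bsub>N\<^esub> m = \<zero>\<^bsub>N\<^esub>" if m: "m \<in> carrier N" for m
      using r
    proof (cases rule: relation_cases)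
      case (orthogonal i k x)
      let ?m = "vertex_elem x \<odot>\<^bsub>N\<^esub> m"
      have m': "?m \<in> vertex_space N x" "loop_elem k x \<odot>\<^bsub>N\<^esub> ?m = loop_elem k x \<odot>\<^bsub>N\<^esub> m"
        using vertex_smult_mem[OF m] loop_smult_vertex(1)[OF orthogonal(1) m] by simp_all
      have "loop_elem i x \<odot>\<^bsub>N\<^esub> (loop_elem k x \<odot>\<^bsub>N\<^esub> m) = \<zero>\<^bsub>N\<^esub>"
      proof (cases "i \<in> nonzero_loops N x \<and> k \<in> nonzero_loops N x")
        case True
        then show ?thesis using D[OF orthogonal(1) _ _ orthogonal(4) m'(1)] m'(2) by simp
      next
        case False
        then show ?thesis
        proof (cases "k \<in> nonzero_loops N x")
          case True
          then show ?thesis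
            using False loop_annihilates[OF orthogonal(1) loop_closed[OF orthogonal(1) m]] by simp
        next
          case False
          then show ?thesis
            using loop_annihilates[OF orthogonal(1) m] smult_zero[OF elem_closed(1)[OF orthogonal(1)]]
            by simp
        qed
      qed
      then show ?thesis
        unfolding orthogonal(5) orthogonality_smult[OF orthogonal(1) m] .
    next
      case (decomposition x)
      let ?m = "vertex_elem x \<odot>\<^bsub>N\<^esub> m"
      have "(\<Oplus>\<^bsub>N\<^esub>i\<in>nonzero_loops N x. loop_elem i x \<odot>\<^bsub>N\<^esub> ?m)
          = (\<Oplus>\<^bsub>N\<^esub>i\<in>level j. loop_elem i x \<odot>\<^bsub>N\<^esub> m)"
        by (rule M.add.finprod_mono_neutral_cong_left)
          (use loops[OF decomposition(1)] loop_annihilates[OF decomposition(1) m]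
            loop_smult_vertex(1)[OF decomposition(1) m] loop_closed[OF decomposition(1) m] in auto)
      then have "(\<Oplus>\<^bsub>N\<^esub>i\<in>level j. loop_elem i x \<odot>\<^bsub>N\<^esub> m) = vertex_elem x \<odot>\<^bsub>N\<^esub> m"
        using S[OF decomposition(1) vertex_smult_mem[OF m]] by simp
      then show ?thesis
        unfolding decomposition(2) sum_relation_smult_eq_zero_iff[OF decomposition(1) m] .
    qed
    moreover have "r \<in> carrier (CQ_hat Q)"
      using relations_closed r ring_hom_closed[OF inclusion_CQ] by blast
    ultimately show "r \<in> annihilator" by (simp add: annihilator_iff)
  qed
  interpret incl: ring_hom_ring "CQ Q j" "CQ_hat Q" "\<lambda>f. f"
    by (rule ring_hom_ringI2[OF CQ_ring CQ_hat_ring inclusion_CQ])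
  have ideal: "I_ideal Q j \<subseteq> {r \<in> carrier (CQ Q j). r \<in> annihilator}"
    by (rule I_ideal_subset[OF incl.ideal_vimage[OF annihilator_ideal]])
      (use rel relations_closed in blast)
  have kf: "?k f \<in> carrier (CQ Q j)"
    by (rule ring_hom_closed[OF kill_hom_CQ_hat f])
  have "?k f \<in> I_ideal Q j"
    using ker unfolding W_proj_def W_class_eq_zero_iff[OF kf] .
  then have inner: "?k f \<in> annihilator" using ideal by blast
  have "f \<ominus>\<^bsub>CQ_hat Q\<^esub> ?k f \<in> annihilator"
  proof (rule diff_kill_arrows_mem_ideal[OF loops_wf[of UNIV], folded CQ_hat_def])
    show "wide_subquiver (with_loops Q (level j)) (with_loops Q UNIV)"
      by (rule with_loops_wide_subquiver) simp
    show "ideal annihilator (CQ_hat Q)" "f \<in> carrier (CQ_hat Q)"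
      by (rule annihilator_ideal f)+
    fix a assume "a \<in> arcs (with_loops Q UNIV) - arcs (with_loops Q (level j))"
    then obtain i x where "a = Loop i x" "x \<in> verts Q" "i \<notin> level j"
      unfolding with_loops_simps by blast
    then show "basis_path (tail (with_loops Q UNIV) a, [a], head (with_loops Q UNIV) a)
        \<in> annihilator"
      using outer by (simp add: with_loops_simps loop_elem_def)
  qed
  then have "f \<odot>\<^bsub>N\<^esub> m = ?k f \<odot>\<^bsub>N\<^esub> m" if "m \<in> carrier N" for m
    using minus_smult_eq_zero_iff[OF f _ that, of "?k f"] inner that unfolding annihilator_iff by blast
  then show ?thesis
    using inner f unfolding annihilator_iff by simp
qed

text \<open>
  Idempotency is not among the relations, but it follows from them: apply the decomposition of the
  identity to \<open>loop_elem i x \<odot>\<^bsub>N\<^esub> m\<close>, where by orthogonality only the term with index \<open>i\<close> survives.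
\<close>

lemma idem_decompositionI:
  assumes rel: "relations Q j \<subseteq> annihilator"
    and outer: "\<And>i x. \<lbrakk>x \<in> verts Q; i \<notin> level j\<rbrakk> \<Longrightarrow> loop_elem i x \<in> annihilator"
  shows "idem_decomposition Q N"
  unfolding idem_decomposition_def
proof (intro ballI conjI impI)
  fix x assume x: "x \<in> verts Q"
  have loops: "nonzero_loops N x \<subseteq> level j"
  proof
    fix i assume "i \<in> nonzero_loops N x"
    then obtain m where m: "m \<in> vertex_space N x" "loop_elem i x \<odot>\<^bsub>N\<^esub> m \<noteq> \<zero>\<^bsub>N\<^esub>"
      unfolding nonzero_loops_def by blast
    have "m \<in> carrier N" using m(1) vertex_space_subset[OF x] by (rule rev_subsetD)
    then have "loop_elem i x \<notin> annihilator" using m(2) unfolding annihilator_iff by blast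
    then show "i \<in> level j" using outer[OF x, of i] by argo
  qed
  then show "finite (nonzero_loops N x)" by (rule finite_subset) simp
  have orth: "loop_elem i x \<odot>\<^bsub>N\<^esub> (loop_elem k x \<odot>\<^bsub>N\<^esub> m) = \<zero>\<^bsub>N\<^esub>"
    if "i \<in> level j" "k \<in> level j" "i \<noteq> k" "m \<in> carrier N" for i k m
  proof -
    have "basis_path (x, [Loop k x, Loop i x], x) \<odot>\<^bsub>N\<^esub> m = \<zero>\<^bsub>N\<^esub>"
      using subsetD[OF rel relationsI(1)[OF x that(1-3)]] that(4) unfolding annihilator_iff by simp
    then show ?thesis unfolding orthogonality_smult[OF x that(4)] .
  qed
  have sum: "(\<Oplus>\<^bsub>N\<^esub>i\<in>level j. loop_elem i x \<odot>\<^bsub>N\<^esub> m) = vertex_elem x \<odot>\<^bsub>N\<^esub> m"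
    if m: "m \<in> carrier N" for m
  proof -
    have "(\<lambda>p. (\<Sum>i\<in>level j. loop_elem i x p) - vertex_elem x p) \<odot>\<^bsub>N\<^esub> m = \<zero>\<^bsub>N\<^esub>"
      using subsetD[OF rel relationsI(2)[OF x]] m unfolding annihilator_iff by simp
    then show ?thesis unfolding sum_relation_smult_eq_zero_iff[OF x m] .
  qed
  show "loop_elem i x \<odot>\<^bsub>N\<^esub> (loop_elem k x \<odot>\<^bsub>N\<^esub> m) = \<zero>\<^bsub>N\<^esub>"
    if "i \<in> nonzero_loops N x" "k \<in> nonzero_loops N x" "i \<noteq> k" "m \<in> vertex_space N x" for i k m
    using that loops vertex_space_subset[OF x] by (intro orth) auto
  show "loop_elem i x \<odot>\<^bsub>N\<^esub> (loop_elem i x \<odot>\<^bsub>N\<^esub> m) = loop_elem i x \<odot>\<^bsub>N\<^esub> m"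
    if i: "i \<in> nonzero_loops N x" and "m \<in> vertex_space N x" for i m
  proof -
    have m: "m \<in> carrier N" using that vertex_space_subset[OF x] by auto
    let ?l = "\<lambda>k. loop_elem k x \<odot>\<^bsub>N\<^esub> (loop_elem i x \<odot>\<^bsub>N\<^esub> m)"
    have l: "?l k \<in> carrier N" for k by (intro loop_closed x m)
    have "loop_elem i x \<odot>\<^bsub>N\<^esub> m = vertex_elem x \<odot>\<^bsub>N\<^esub> (loop_elem i x \<odot>\<^bsub>N\<^esub> m)"
      using loop_smult_vertex(2)[OF x m] by simp
    also have "\<dots> = (\<Oplus>\<^bsub>N\<^esub>k\<in>level j. ?l k)"
      using sum[OF loop_closed[OF x m]] by simp
    also have "\<dots> = (\<Oplus>\<^bsub>N\<^esub>k\<in>{i}. ?l k)"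
      by (rule M.add.finprod_mono_neutral_cong_right) (use i loops orth[of _ i m] m l in auto)
    also have "\<dots> = ?l i"
      using l by simp
    finally show ?thesis by simp
  qed
  show "(\<Oplus>\<^bsub>N\<^esub>i\<in>nonzero_loops N x. loop_elem i x \<odot>\<^bsub>N\<^esub> m) = m" if "m \<in> vertex_space N x" for m
  proof -
    have m: "m \<in> carrier N" using that vertex_space_subset[OF x] by auto
    have "(\<Oplus>\<^bsub>N\<^esub>i\<in>nonzero_loops N x. loop_elem i x \<odot>\<^bsub>N\<^esub> m) = (\<Oplus>\<^bsub>N\<^esub>i\<in>level j. loop_elem i x \<odot>\<^bsub>N\<^esub> m)"
      by (rule M.add.finprod_mono_neutral_cong_left)
        (use loops loop_annihilates[OF x m] loop_closed[OF x m] in auto)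
    then show ?thesis
      using sum[OF m] vertex_smult_vertex_space[OF x that] by simp
  qed
qed

end

context finite_quiver
begin

lemma restrict_W_module_idem:
  assumes M: "M \<in> Obj (Mod_W Q j)"
  shows "idem_decomposition Q (restrict_module (CQ_hat Q) (W_proj Q j) M)"
proof -
  let ?N = "restrict_module (CQ_hat Q) (W_proj Q j) M"
  have M': "left_module (W Q j) M" using M by (simp add: Mod_W_def Mod_cat_simps)
  interpret M: left_module "W Q j" M by (rule M')
  interpret N: finite_quiver_module Q ?N
    by (intro finite_quiver_module.intro finite_quiver_axioms hat.restrict_left_module[OF M'])
  have ker: "f \<in> N.annihilator" if "f \<in> carrier (CQ_hat Q)" "W_proj Q j f = \<zero>\<^bsub>W Q j\<^esub>" for f
    unfolding N.annihilator_iff using that by (simp add: hat.restrict_smult M.zero_smult)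
  show ?thesis
  proof (rule N.idem_decompositionI)
    show "relations Q j \<subseteq> N.annihilator"
    proof
      fix r assume r: "r \<in> relations Q j"
      then have c: "r \<in> carrier (CQ Q j)" using relations_closed by blast
      have "W_proj Q j r = W_class Q j r"
        using kill_arrows_id c unfolding W_proj_def CQ_def by metis
      also have "\<dots> = \<zero>\<^bsub>W Q j\<^esub>"
        unfolding W_class_eq_zero_iff[OF c] using r relations_subset_I_ideal by blast
      finally show "r \<in> N.annihilator"
        by (rule ker[OF ring_hom_closed[OF N.inclusion_CQ c]])
    qed
  next
    fix i x assume x: "x \<in> verts Q" and i: "i \<notin> level j"
    have "kill_arrows (with_loops Q (level j)) (loop_elem i x) = \<zero>\<^bsub>CQ Q j\<^esub>"
      unfolding loop_elem_def kill_arrows_basis_path loop_path_mem CQ_def path_algebra_simps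
      using i by argo
    then have "W_proj Q j (loop_elem i x) = \<zero>\<^bsub>W Q j\<^esub>"
      unfolding W_proj_def using ring_hom_zero[OF W_class_hom CQ_ring W_ring] by simp
    then show "loop_elem i x \<in> N.annihilator"
      by (rule ker[OF N.elem_closed(1)[OF x]])
  qed
qed

lemma W_module_of_idem:
  assumes N: "N \<in> Obj (Mod_cat (CQ_hat Q) (path_algebra_scalar (with_loops Q UNIV)))"
    and idem: "idem_decomposition Q N"
    and loops: "\<And>x. x \<in> verts Q \<Longrightarrow> nonzero_loops N x \<subseteq> level j"
  obtains M where "M \<in> Obj (Mod_W Q j)" "restrict_module (CQ_hat Q) (W_proj Q j) M = N"
proof -
  have N': "left_module (CQ_hat Q) N" using N by (simp add: Mod_cat_simps)
  interpret N: finite_quiver_module Q N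
    by (intro finite_quiver_module.intro finite_quiver_axioms N')
  interpret proj: ring_hom_ring "CQ_hat Q" "W Q j" "W_proj Q j"
    by (rule ring_hom_ringI2[OF CQ_hat_ring W_ring W_proj_hom])
  show thesis
  proof (rule hat.descend_obj[OF N, of j])
    fix a b m assume ab: "a \<in> carrier (CQ_hat Q)" "b \<in> carrier (CQ_hat Q)"
      "W_proj Q j a = W_proj Q j b" and m: "m \<in> carrier N"
    \<comment> \<open>Elements with equal images differ by an element of the kernel, which acts as zero.\<close>
    have "W_proj Q j (a \<ominus>\<^bsub>CQ_hat Q\<^esub> b) = \<zero>\<^bsub>W Q j\<^esub>"
      using ab by (simp add: a_minus_def proj.S.r_neg)
    then have "a \<ominus>\<^bsub>CQ_hat Q\<^esub> b \<in> N.annihilator"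
      using ab by (intro N.kernel_annihilates[OF idem loops]) simp_all
    then show "a \<odot>\<^bsub>N\<^esub> m = b \<odot>\<^bsub>N\<^esub> m"
      using N.minus_smult_eq_zero_iff[OF ab(1,2) m] m unfolding N.annihilator_iff by blast
  qed (use that in \<open>simp add: Mod_W_def\<close>)
qed

end

section \<open>The colimit\<close>

lemma finite_int_set_level:
  assumes "finite (A :: int set)"
  obtains j where "A \<subseteq> level j"
proof
  \<comment> \<open>The \<open>0\<close> makes the maximum meaningful when \<open>A\<close> is empty.\<close>
  show "A \<subseteq> level (nat (Max (insert 0 (abs ` A))))"
  proof
    fix i assume "i \<in> A"
    then have "\<bar>i\<bar> \<le> Max (insert 0 (abs ` A))" using assms by (intro Max_ge) auto
    then show "i \<in> level (nat (Max (insert 0 (abs ` A))))" by auto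
  qed
qed

lemma i_functor_refl: "i_functor Q j j = id_functor"
  by (cases j) simp_all

lemma i_functor_Suc: "j \<le> k \<Longrightarrow> i_functor Q j (Suc k) = i_step Q k \<circ>\<^sub>F i_functor Q j k"
  by simp

context finite_quiver
begin

lemma Mod_W_is_category: "is_category (Mod_W Q j)"
  unfolding Mod_W_def by (rule Mod_cat_is_category)

lemma Mod_Idem_is_category: "is_category (Mod_Idem Q)"
  unfolding Mod_Idem_def by (intro full_subcategory_is_category Mod_cat_is_category)

lemma i_step_is_functor: "is_functor (Mod_W Q j) (Mod_W Q (Suc j)) (i_step Q j)"
  unfolding Mod_W_def i_step_def by (rule step.restriction_is_functor)

lemma i_functor_is_functor:
  assumes "j \<le> k"
  shows "is_functor (Mod_W Q j) (Mod_W Q k) (i_functor Q j k)"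
  using assms
proof (induction k rule: dec_induct)
  case base
  show ?case unfolding i_functor_refl by (rule id_is_functor)
next
  case (step k)
  show ?case
    unfolding i_functor_Suc[OF step.hyps(1)]
    by (rule comp_is_functor[OF Mod_W_is_category step.IH i_step_is_functor])
qed

lemma i_functor_comp:
  assumes "i \<le> j" "j \<le> k"
  shows "i_functor Q j k \<circ>\<^sub>F i_functor Q i j = i_functor Q i k"
  using assms(2)
proof (induction k rule: dec_induct)
  case base
  show ?case by (simp add: i_functor_refl comp_functor_def id_functor_def)
next
  case (step k)
  then show ?case using assms(1) by (simp add: comp_functor_assoc)
qed

lemma Mod_W_direct_system: "direct_system (Mod_W Q) (i_functor Q)"
  unfolding direct_system_def
  by (simp add: Mod_W_is_category i_functor_is_functor i_functor_refl i_functor_comp functor_eq_def)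

text \<open>
  Restricting in two steps, through \<open>W\<^bsub>j+1\<^esub>(Q)\<close>, is the same as restricting directly, with equality
  of modules and not only an isomorphism.
\<close>

lemma restrict_step:
  "restrict_module (CQ_hat Q) (W_proj Q (Suc j)) (restrict_module (W Q (Suc j)) (W_surj Q j) M)
    = restrict_module (CQ_hat Q) (W_proj Q j) M"
proof -
  have "restrict_module (CQ_hat Q) (W_proj Q (Suc j)) (restrict_module (W Q (Suc j)) (W_surj Q j) M)
    = restrict_module (CQ_hat Q) (\<lambda>f. W_surj Q j (W_proj Q (Suc j) f)) M"
    by (rule restrict_module_comp) (rule hat.h_closed)
  also have "\<dots> = restrict_module (CQ_hat Q) (W_proj Q j) M"
    by (rule restrict_module_cong) (rule W_surj_proj)
  finally show ?thesis .
qed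

lemma to_Idem_step: "to_Idem Q (Suc j) \<circ>\<^sub>F i_step Q j = to_Idem Q j"
  by (auto simp: to_Idem_eq i_step_def restriction_functor_def comp_functor_def restrict_step
      fun_eq_iff)

lemma to_Idem_i_functor:
  assumes "j \<le> k"
  shows "to_Idem Q k \<circ>\<^sub>F i_functor Q j k = to_Idem Q j"
  using assms
proof (induction k rule: dec_induct)
  case base
  show ?case by (simp add: i_functor_refl comp_functor_def id_functor_def)
next
  case (step k)
  then show ?case by (simp add: comp_functor_assoc[symmetric] to_Idem_step)
qed

lemma to_Idem_is_functor: "is_functor (Mod_W Q j) (Mod_Idem Q) (to_Idem Q j)"
  unfolding Mod_Idem_def
proof (rule functor_into_full_subcategory[OF _ _ Mod_W_is_category])
  show "is_functor (Mod_W Q j) (Mod_cat (CQ_hat Q) (path_algebra_scalar (with_loops Q UNIV)))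
      (to_Idem Q j)"
    unfolding Mod_W_def to_Idem_eq by (rule hat.restriction_is_functor)
  fix M :: "(('x, 'e) loop_vector set, 'c) module" assume "M \<in> Obj (Mod_W Q j)"
  then show "idem_decomposition Q (FObj (to_Idem Q j) M)"
    using restrict_W_module_idem by (simp add: to_Idem_eq restriction_functor_def)
qed

lemma Mod_Idem_is_target: "is_target (Mod_W Q) (i_functor Q) (Mod_Idem Q) (to_Idem Q)"
  unfolding is_target_def
  by (simp add: Mod_Idem_is_category to_Idem_is_functor to_Idem_i_functor functor_eq_def)

lemma nonzero_loops_bounded:
  assumes "idem_decomposition Q N"
  shows "\<exists>j. \<forall>x\<in>verts Q. nonzero_loops N x \<subseteq> level j"
proof -
  have "finite (\<Union>x\<in>verts Q. nonzero_loops N x)"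
    using assms finite_verts unfolding idem_decomposition_def by blast
  then obtain j where "(\<Union>x\<in>verts Q. nonzero_loops N x) \<subseteq> level j"
    by (rule finite_int_set_level)
  then show ?thesis by blast
qed

text \<open>
  The bound \<open>j\<close> has to serve for the source and the target of the arrow simultaneously; then both
  modules descend to \<open>W\<^sub>j(Q)\<close>, and the arrow descends with them by fullness.
\<close>

lemma Mod_Idem_arr_in_image:
  assumes "a \<in> Arr (Mod_Idem Q)"
  shows "\<exists>j. a \<in> FArr (to_Idem Q j) ` Arr (Mod_W Q j)"
proof -
  let ?D = "Mod_cat (CQ_hat Q) (path_algebra_scalar (with_loops Q UNIV))"
  obtain N f N' where a: "a = (N, f, N')" by (cases a)
  have arr: "(N, f, N') \<in> Arr ?D" and idem: "idem_decomposition Q N" "idem_decomposition Q N'"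
    using assms unfolding a Mod_Idem_def full_subcategory_def by (simp_all add: Mod_cat_simps(3,4))
  have NN': "N \<in> Obj ?D" "N' \<in> Obj ?D" using arr unfolding Mod_cat_simps(2) by blast+
  obtain i where i: "\<forall>x\<in>verts Q. nonzero_loops N x \<subseteq> level i"
    using nonzero_loops_bounded[OF idem(1)] by blast
  obtain i' where i': "\<forall>x\<in>verts Q. nonzero_loops N' x \<subseteq> level i'"
    using nonzero_loops_bounded[OF idem(2)] by blast
  define j where "j = max i i'"
  have j: "level i \<subseteq> level j" "level i' \<subseteq> level j" by (auto simp: j_def)
  obtain M where M: "M \<in> Obj (Mod_W Q j)" "restrict_module (CQ_hat Q) (W_proj Q j) M = N"
    using W_module_of_idem[OF NN'(1) idem(1) order_trans[OF bspec[OF i] j(1)]] .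
  obtain M' where M': "M' \<in> Obj (Mod_W Q j)" "restrict_module (CQ_hat Q) (W_proj Q j) M' = N'"
    using W_module_of_idem[OF NN'(2) idem(2) order_trans[OF bspec[OF i'] j(2)]] .
  have "a \<in> FArr (to_Idem Q j) ` Arr (Mod_W Q j)"
    using hat.arr_in_image[of M j M' f] M M' arr unfolding a Mod_W_def to_Idem_eq by simp
  then show ?thesis ..
qed

lemma to_Idem_inj_on_arr: "inj_on (FArr (to_Idem Q j)) (Arr (Mod_W Q j))"
  unfolding to_Idem_eq Mod_W_def by (rule hat.restriction_inj_on_arr)

lemma Mod_Idem_is_colimit: "is_colimit T (Mod_W Q) (i_functor Q) (Mod_Idem Q) (to_Idem Q)"
  by (rule exhaustive_embeddings_colimit[OF Mod_W_direct_system Mod_Idem_is_target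
        to_Idem_inj_on_arr Mod_Idem_arr_in_image])

end

theorem proposition2p16:
  fixes Q :: "('x, 'e) pre_digraph"
  assumes "fin_digraph Q"
  shows
    "is_colimit TYPE(('yo, 'ym) category)
       (Mod_W Q :: nat \<Rightarrow> (('x, 'e) loop_vector set, 'v) module_category) (i_functor Q)
       (Mod_Idem Q :: (('x, 'e) loop_vector, 'v) module_category) (to_Idem Q) \<and>
     (\<forall>(X :: ('xo, 'xm) category) \<Phi>.
        is_colimit TYPE(('xo, 'xm) category)
          (Mod_W Q :: nat \<Rightarrow> (('x, 'e) loop_vector set, 'v) module_category) (i_functor Q) X \<Phi> \<and>
        is_colimit TYPE((('x, 'e) loop_vector, 'v) module_category)
          (Mod_W Q :: nat \<Rightarrow> (('x, 'e) loop_vector set, 'v) module_category) (i_functor Q) X \<Phi> \<longrightarrow>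
        equivalent_categories X (Mod_Idem Q :: (('x, 'e) loop_vector, 'v) module_category))"
proof -
  interpret finite_quiver Q
    by (rule finite_quiver.intro[OF fin_digraph.axioms(1)[OF assms] fin_digraph.finite_verts[OF assms]])
  show ?thesis
    using Mod_Idem_is_colimit colimits_equivalent[OF _ _ Mod_Idem_is_colimit Mod_Idem_is_colimit]
    by blast
qed

end
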